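(* Let $\kappa>0$. For each $N$, let $\mathcal{G}=\mathcal{G}_N=([N],E)$ be a graph with average degree $d=d_N$ and maximum degree $d_{\max}$, and let $G=G_N$ be a symmetric $\kappa^2$-subgaussian $N\times N$ random matrix with vanishing diagonal. Assume that $d/\log N\to\infty$ as $N\to\infty$ and that $d_{\max}\le C_0 d$ for all $N$, where $C_0>0$ is a constant independent of $N$. Let $J=\frac1{\sqrt d}A\circ G$, where $A$ is the adjacency matrix of $\mathcal{G}$. Then there exist constants $C,K>0$, independent of $N$ and depending on $\kappa$, such that $$\mathbb{P}(\|J\|\ge C)\le K\exp(-d/\log N)$$ for all $N$, where $\|J\|$ is the operator norm.
   Context: $[N]=\{1,\dots,N\}$, $N\ge2$; the graphs are deterministic, simple and undirected, with at least one edge (so $d>0$ and $J$ is defined). The average degree is $d=2|E|/N$ and $d_{\max}$ is the maximum degree. $A\circ G$ is the Hadamard (entrywise) product. A random variable $X$ is $\kappa^2$-subgaussian if $\mathbb{E}X=0$ and $\mathbb{E}e^{sX}\le e^{\kappa^2s^2/2}$ for all $s\in\mathbb{R}$. $G=(g_{ij})$ is a symmetric $\kappa^2$-subgaussian matrix with vanishing diagonal if $g_{ij}=g_{ji}$, $g_{ii}=0$, and its entries above the diagonal are independent $\kappa^2$-subgaussian random variables. *)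

theory Defs
  imports "HOL-Probability.Probability"
begin

(* Matrices with a varying dimension N are functions of two indices, which are only ever
   read on {1..N}. *)

section \<open>Graphs on the vertex set \<open>{1..N}\<close>\<close>

text \<open>A simple undirected graph is given by its set of edges, each a two-element set of vertices.\<close>

definition simple_graph :: "nat \<Rightarrow> nat set set \<Rightarrow> bool" where
  "simple_graph N E \<longleftrightarrow> E \<subseteq> {e. e \<subseteq> {1..N} \<and> card e = 2}"

definition degree :: "nat set set \<Rightarrow> nat \<Rightarrow> nat" where
  "degree E v = card {e \<in> E. v \<in> e}"

definition max_degree :: "nat \<Rightarrow> nat set set \<Rightarrow> nat" where
  "max_degree N E = Max (degree E ` {1..N})"

definition avg_degree :: "nat \<Rightarrow> nat set set \<Rightarrow> real" where
  "avg_degree N E = 2 * real (card E) / real N"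

text \<open>The diagonal vanishes because \<open>{i, i}\<close> is a singleton and hence not an edge.\<close>

definition adjacency :: "nat set set \<Rightarrow> nat \<Rightarrow> nat \<Rightarrow> real" where
  "adjacency E i j = (if {i, j} \<in> E then 1 else 0)"


section \<open>Matrices\<close>

definition hadamard :: "(nat \<Rightarrow> nat \<Rightarrow> real) \<Rightarrow> (nat \<Rightarrow> nat \<Rightarrow> real) \<Rightarrow> nat \<Rightarrow> nat \<Rightarrow> real" where
  "hadamard A B i j = A i j * B i j"

text \<open>
  The norm induced by the Euclidean norm on vectors indexed by \<open>{1..N}\<close>. Values of \<open>x\<close>
  outside \<open>{1..N}\<close> play no role, and the supremum is over a nonempty set of reals that is
  bounded above.
\<close>

definition op_norm :: "nat \<Rightarrow> (nat \<Rightarrow> nat \<Rightarrow> real) \<Rightarrow> real" where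
  "op_norm N B =
     (SUP x\<in>{x :: nat \<Rightarrow> real. L2_set x {1..N} \<le> 1}.
        L2_set (\<lambda>i. \<Sum>j\<in>{1..N}. B i j * x j) {1..N})"


section \<open>Subgaussian variables and matrices\<close>

text \<open>
  The parameter \<open>v\<close> is the variance proxy \<open>\<kappa>\<^sup>2\<close>. Integrability is required
  explicitly because the Bochner integral of a non-integrable function is 0.
\<close>

definition subgaussian :: "'a measure \<Rightarrow> real \<Rightarrow> ('a \<Rightarrow> real) \<Rightarrow> bool" where
  "subgaussian M v X \<longleftrightarrow>
     integrable M X \<and> (\<integral>\<omega>. X \<omega> \<partial>M) = 0 \<and>
     (\<forall>s::real. integrable M (\<lambda>\<omega>. exp (s * X \<omega>)) \<and>
        (\<integral>\<omega>. exp (s * X \<omega>) \<partial>M) \<le> exp (v * s\<^sup>2 / 2))"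

definition subgaussian_matrix ::
  "'a measure \<Rightarrow> nat \<Rightarrow> real \<Rightarrow> ('a \<Rightarrow> nat \<Rightarrow> nat \<Rightarrow> real) \<Rightarrow> bool" where
  "subgaussian_matrix M N v G \<longleftrightarrow>
     (\<forall>\<omega>\<in>space M. \<forall>i\<in>{1..N}. \<forall>j\<in>{1..N}. G \<omega> i j = G \<omega> j i) \<and>
     (\<forall>\<omega>\<in>space M. \<forall>i\<in>{1..N}. G \<omega> i i = 0) \<and>
     (\<forall>i\<in>{1..N}. \<forall>j\<in>{1..N}. i < j \<longrightarrow> subgaussian M v (\<lambda>\<omega>. G \<omega> i j)) \<and>
     prob_space.indep_vars M (\<lambda>_. borel) (\<lambda>(i, j) \<omega>. G \<omega> i j)
       {(i, j). i \<in> {1..N} \<and> j \<in> {1..N} \<and> i < j}"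

definition J_matrix ::
  "nat \<Rightarrow> nat set set \<Rightarrow> (nat \<Rightarrow> nat \<Rightarrow> real) \<Rightarrow> nat \<Rightarrow> nat \<Rightarrow> real" where
  "J_matrix N E B i j = 1 / sqrt (avg_degree N E) * hadamard (adjacency E) B i j"

end

theory Submission
  imports Defs
begin

text \<open>
  The proof is by the moment method, with a comparison of the sparse matrix to a full matrix whose dimension
  is proportional to the degree. Let \<open>X\<close> be the Hadamard product of the adjacency matrix with \<open>G\<close>, let \<open>d\<close> be the average and
  \<open>D\<close> the maximum degree. Then \<open>op_norm X ^ (2 * D)\<close> is at most the trace of \<open>X ^ (2 * D)\<close>
  (\<open>op_norm_le_trace_pow\<close>), and the expectation of this trace is a sum over closed walks of
  length \<open>2 * D\<close> in the graph. By independence each walk contributes a product of moments of entries.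

  The moments of order up to \<open>2 * D\<close> of a subgaussian entry are bounded, up to a scaling, by those of a centred
  subgaussian law with nonnegative moments that depends only on \<open>D\<close>
  (\<open>subgaussian_moment_le_law_moment\<close>). The law is not symmetric, so that
  it also dominates the odd moments, and no symmetrisation is needed. After this replacement the contribution of
  a walk depends only on its pattern, that is, on which of its vertices coincide. A pattern with \<open>m\<close> distinct
  vertices is realised by at most \<open>N * D ^ (m - 1)\<close> walks in the graph, and by at least
  \<open>r * D ^ (m - 1)\<close> lists over \<open>{1..r}\<close> if \<open>r = 3 * D\<close>. Hence the sum over the walks is at most \<open>N / r\<close> times
  the expected trace of \<open>Y ^ (2 * D)\<close> (\<open>sum_walks_le_sum_lists\<close>, \<open>prod_expect_trace_pow\<close>), where \<open>Y\<close> is a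
  full symmetric \<open>r \<times> r\<close> matrix whose entries are independent with the comparison law. Because this law
  has only finitely many atoms, its product is handled by finite sums.

  For \<open>Y\<close> a net suffices: its operator norm is at most twice the maximum of the bilinear form over pairs
  of points from a grid with at most \<open>48 ^ r\<close> points, and each value of the form is subgaussian
  (\<open>law_expect_trace_pow\<close>). As \<open>r\<close> is proportional to the order of the moment, the size of the grid only
  affects the constant, and the expected trace of \<open>X ^ (2 * D)\<close> is at most \<open>N * (H * D) ^ D\<close>, where \<open>H\<close> depends only
  on \<open>\<kappa>\<close>. Markov's inequality and \<open>D \<le> C\<^sub>0 * d\<close> bound the tail of \<open>op_norm J\<close> by \<open>N * exp (- 2 * D)\<close>
  for a suitable threshold. This is at most \<open>exp (- d)\<close> as soon as \<open>ln N \<le> d\<close>, and the growth of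
  \<open>d / ln N\<close> leaves only finitely many other \<open>N\<close>. For \<open>N \<ge> 3\<close> the bound \<open>exp (- d)\<close> is stronger than the
  stated \<open>exp (- d / ln N)\<close>.
\<close>

text \<open>This keeps the simplifier from rewriting \<open>{1..N}\<close> to \<open>{Suc 0..N}\<close>.\<close>

declare One_nat_def [simp del]

section \<open>Operator norm and traces of powers\<close>

text \<open>
  The product of a matrix with a vector. As for matrices, indices outside \<open>{1..N}\<close> play no role in the argument.
\<close>

definition mat_vec :: "nat \<Rightarrow> (nat \<Rightarrow> nat \<Rightarrow> real) \<Rightarrow> (nat \<Rightarrow> real) \<Rightarrow> nat \<Rightarrow> real" where
  "mat_vec N B x i = (\<Sum>j\<in>{1..N}. B i j * x j)"

text \<open>
  Powers of a matrix over the index set \<open>{1..N}\<close>, and their traces. The values at other indices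
  have no meaning.
\<close>

primrec mat_pow :: "nat \<Rightarrow> (nat \<Rightarrow> nat \<Rightarrow> real) \<Rightarrow> nat \<Rightarrow> nat \<Rightarrow> nat \<Rightarrow> real" where
  "mat_pow N B 0 i j = (if i = j then 1 else 0)"
| "mat_pow N B (Suc k) i j = (\<Sum>l\<in>{1..N}. B i l * mat_pow N B k l j)"

definition trace_pow :: "nat \<Rightarrow> (nat \<Rightarrow> nat \<Rightarrow> real) \<Rightarrow> nat \<Rightarrow> real" where
  "trace_pow N B n = (\<Sum>i\<in>{1..N}. mat_pow N B n i i)"

lemma op_norm_eq: "op_norm N B = (SUP x\<in>{x. L2_set x {1..N} \<le> 1}. L2_set (mat_vec N B x) {1..N})"
  by (simp add: op_norm_def mat_vec_def[abs_def])

lemma L2_set_sq: "(L2_set f A)\<^sup>2 = (\<Sum>i\<in>A. (f i)\<^sup>2)"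
  unfolding L2_set_def by (simp add: sum_nonneg)

lemma sum_mult_le_L2_set: "(\<Sum>i\<in>A. f i * g i) \<le> L2_set f A * L2_set g A"
proof -
  have "(\<Sum>i\<in>A. f i * g i) \<le> (\<Sum>i\<in>A. \<bar>f i\<bar> * \<bar>g i\<bar>)"
    by (rule sum_mono) (metis abs_ge_self abs_mult)
  also have "\<dots> \<le> L2_set f A * L2_set g A" by (rule L2_set_mult_ineq)
  finally show ?thesis .
qed

text \<open>
  The operator norm is at most the Frobenius norm. In particular the supremum defining \<open>op_norm\<close>
  is over a bounded set.
\<close>

lemma L2_set_mat_vec_le_Frobenius:
  "L2_set (mat_vec N B x) {1..N} \<le> sqrt (\<Sum>i\<in>{1..N}. \<Sum>j\<in>{1..N}. (B i j)\<^sup>2) * L2_set x {1..N}"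
proof -
  have "(mat_vec N B x i)\<^sup>2 \<le> (\<Sum>j\<in>{1..N}. (B i j)\<^sup>2) * (\<Sum>j\<in>{1..N}. (x j)\<^sup>2)" for i
    unfolding mat_vec_def by (rule Cauchy_Schwarz_ineq_sum)
  then have "(\<Sum>i\<in>{1..N}. (mat_vec N B x i)\<^sup>2)
      \<le> (\<Sum>i\<in>{1..N}. \<Sum>j\<in>{1..N}. (B i j)\<^sup>2) * (\<Sum>j\<in>{1..N}. (x j)\<^sup>2)"
    unfolding sum_distrib_right by (rule sum_mono)
  then show ?thesis unfolding L2_set_def by (metis real_sqrt_le_iff real_sqrt_mult)
qed

lemma L2_set_mat_vec_le_op_norm:
  assumes "L2_set x {1..N} \<le> 1"
  shows "L2_set (mat_vec N B x) {1..N} \<le> op_norm N B"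
  unfolding op_norm_eq
proof (rule cSUP_upper)
  show "x \<in> {x. L2_set x {1..N} \<le> 1}" using assms by simp
  show "bdd_above ((\<lambda>x. L2_set (mat_vec N B x) {1..N}) ` {x. L2_set x {1..N} \<le> 1})"
  proof (rule bdd_aboveI2)
    fix x :: "nat \<Rightarrow> real" assume "x \<in> {x. L2_set x {1..N} \<le> 1}"
    then show "L2_set (mat_vec N B x) {1..N} \<le> sqrt (\<Sum>i\<in>{1..N}. \<Sum>j\<in>{1..N}. (B i j)\<^sup>2)"
      using L2_set_mat_vec_le_Frobenius[of N B x]
      by (smt (verit, best) mem_Collect_eq mult_left_le real_sqrt_ge_zero sum_nonneg zero_le_power2)
  qed
qed

lemma op_norm_leI:
  assumes "\<And>x. L2_set x {1..N} \<le> 1 \<Longrightarrow> L2_set (mat_vec N B x) {1..N} \<le> c"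
  shows "op_norm N B \<le> c"
  unfolding op_norm_eq
proof (rule cSUP_least)
  have "L2_set (\<lambda>_. 0 :: real) {1..N} \<le> 1" by (simp add: L2_set_def)
  then show "{x :: nat \<Rightarrow> real. L2_set x {1..N} \<le> 1} \<noteq> {}" by blast
qed (use assms in auto)

lemma op_norm_nonneg: "0 \<le> op_norm N B"
proof -
  have "L2_set (\<lambda>_. 0 :: real) {1..N} \<le> 1" by (simp add: L2_set_def)
  from L2_set_mat_vec_le_op_norm[OF this, of B] show ?thesis
    using L2_set_nonneg order_trans by blast
qed

lemma L2_set_scale: "0 \<le> c \<Longrightarrow> L2_set (\<lambda>i. c * x i) A = c * L2_set x A"
  by (rule L2_set_right_distrib[symmetric])

lemma L2_set_mat_vec_le: "L2_set (mat_vec N B x) {1..N} \<le> op_norm N B * L2_set x {1..N}"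
proof (cases "L2_set x {1..N} = 0")
  case True
  then have "\<forall>i\<in>{1..N}. x i = 0" by (simp add: L2_set_eq_0_iff)
  then have "mat_vec N B x i = 0" for i by (simp add: mat_vec_def)
  then show ?thesis using True by (simp add: L2_set_def)
next
  case False
  define t where "t = L2_set x {1..N}"
  have t: "t > 0" unfolding t_def by (metis False L2_set_nonneg less_eq_real_def)
  have "L2_set (\<lambda>i. (1/t) * x i) {1..N} = 1/t * t" using t unfolding t_def by (subst L2_set_scale) auto
  then have "L2_set (\<lambda>i. (1/t) * x i) {1..N} \<le> 1" using t by simp
  from L2_set_mat_vec_le_op_norm[OF this, of B]
  have "L2_set (mat_vec N B (\<lambda>i. (1/t) * x i)) {1..N} \<le> op_norm N B" .
  moreover have "mat_vec N B (\<lambda>i. (1/t) * x i) = (\<lambda>i. (1/t) * mat_vec N B x i)"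
    by (simp add: mat_vec_def[abs_def] sum_distrib_left mult_ac)
  ultimately have "(1/t) * L2_set (mat_vec N B x) {1..N} \<le> op_norm N B"
    using t by (simp add: L2_set_scale[of "1/t", simplified])
  then show ?thesis using t by (simp add: t_def field_simps)
qed

lemma mat_pow_add:
  assumes "i \<in> {1..N}"
  shows "mat_pow N B (m + n) i j = (\<Sum>l\<in>{1..N}. mat_pow N B m i l * mat_pow N B n l j)"
  using assms
proof (induction m arbitrary: i)
  case 0
  then show ?case by (simp add: if_distrib[of "\<lambda>t. t * _"] sum.delta cong: if_cong)
next
  case (Suc m)
  have "mat_pow N B (Suc m + n) i j
      = (\<Sum>k\<in>{1..N}. B i k * (\<Sum>l\<in>{1..N}. mat_pow N B m k l * mat_pow N B n l j))"
    unfolding add_Suc mat_pow.simps by (intro sum.cong refl arg_cong2[where f = "(*)"] Suc.IH)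
  also have "\<dots> = (\<Sum>l\<in>{1..N}. \<Sum>k\<in>{1..N}. B i k * mat_pow N B m k l * mat_pow N B n l j)"
    by (subst sum.swap) (simp add: sum_distrib_left mult_ac)
  finally show ?case by (simp add: sum_distrib_right)
qed

lemma mat_pow_sym:
  assumes sym: "\<And>i j. i \<in> {1..N} \<Longrightarrow> j \<in> {1..N} \<Longrightarrow> B i j = B j i"
    and "i \<in> {1..N}" "j \<in> {1..N}"
  shows "mat_pow N B k i j = mat_pow N B k j i"
  using assms(2,3)
proof (induction k arbitrary: i j)
  case 0 then show ?case by auto
next
  case (Suc k)
  have one: "mat_pow N B 1 l j = B l j" if "l \<in> {1..N}" for l
    unfolding One_nat_def mat_pow.simps using Suc.prems
    by (simp add: if_distrib[of "\<lambda>t. _ * t"] sum.delta cong: if_cong)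
  have "mat_pow N B (Suc k) i j = (\<Sum>l\<in>{1..N}. mat_pow N B k i l * mat_pow N B 1 l j)"
    using mat_pow_add[OF Suc.prems(1), where m = k and n = 1 and j = j and B = B] by (simp only: Suc_eq_plus1)
  also have "\<dots> = (\<Sum>l\<in>{1..N}. B j l * mat_pow N B k l i)"
    using one Suc.IH Suc.prems sym by (intro sum.cong) auto
  finally show ?case by simp
qed

lemma trace_pow_even:
  assumes sym: "\<And>i j. i \<in> {1..N} \<Longrightarrow> j \<in> {1..N} \<Longrightarrow> B i j = B j i"
  shows "trace_pow N B (2 * p) = (\<Sum>j\<in>{1..N}. \<Sum>i\<in>{1..N}. (mat_pow N B p i j)\<^sup>2)"
proof -
  have "mat_pow N B (2 * p) j j = (\<Sum>i\<in>{1..N}. (mat_pow N B p i j)\<^sup>2)" if "j \<in> {1..N}" for j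
    unfolding mult_2 mat_pow_add[OF that]
    using mat_pow_sym[of N B j _ p] sym that by (intro sum.cong) (auto simp: power2_eq_square)
  then show ?thesis by (simp add: trace_pow_def)
qed

lemma trace_pow_le_op_norm:
  assumes sym: "\<And>i j. i \<in> {1..N} \<Longrightarrow> j \<in> {1..N} \<Longrightarrow> B i j = B j i"
  shows "trace_pow N B (2 * p) \<le> real N * op_norm N B ^ (2 * p)"
proof -
  have col: "L2_set (\<lambda>i. mat_pow N B k i j) {1..N} \<le> op_norm N B ^ k" if "j \<in> {1..N}" for k j
  proof (induction k)
    case 0
    have "(\<Sum>i\<in>{1..N}. (if i = j then 1 else 0 :: real)\<^sup>2) = (\<Sum>i\<in>{1..N}. if i = j then 1 else 0)"
      by (intro sum.cong) auto
    then show ?case using that by (simp add: L2_set_def sum.delta)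
  next
    case (Suc k)
    have "L2_set (\<lambda>i. mat_pow N B (Suc k) i j) {1..N}
        = L2_set (mat_vec N B (\<lambda>i. mat_pow N B k i j)) {1..N}"
      by (simp add: mat_vec_def[abs_def])
    also have "\<dots> \<le> op_norm N B * L2_set (\<lambda>i. mat_pow N B k i j) {1..N}"
      by (rule L2_set_mat_vec_le)
    also have "\<dots> \<le> op_norm N B * op_norm N B ^ k"
      using Suc op_norm_nonneg by (intro mult_left_mono) auto
    finally show ?case by simp
  qed
  have "(\<Sum>i\<in>{1..N}. (mat_pow N B p i j)\<^sup>2) \<le> op_norm N B ^ (2 * p)" if "j \<in> {1..N}" for j
    using power_mono[OF col[OF that, of p] L2_set_nonneg, of 2]
    by (simp add: L2_set_sq power_mult[symmetric] mult.commute)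
  then have "trace_pow N B (2 * p) \<le> (\<Sum>j\<in>{1..N}. op_norm N B ^ (2 * p))"
    using trace_pow_even[of N B p] sym by (simp only:) (rule sum_mono)
  then show ?thesis by simp
qed

text \<open>
  No spectral theorem is needed: for a unit vector \<open>x\<close>, the numbers \<open>a k\<close>, the squared norms of
  \<open>B\<^sup>k x\<close>, form a log-convex sequence with \<open>a 0 \<le> 1\<close>, so \<open>a 1 ^ p \<le> a p\<close>; and \<open>a p\<close> is at most the squared
  Frobenius norm of \<open>B\<^sup>p\<close>, which is the trace of \<open>B\<^sup>2\<^sup>p\<close>.
\<close>

lemma op_norm_le_trace_pow:
  assumes sym: "\<And>i j. i \<in> {1..N} \<Longrightarrow> j \<in> {1..N} \<Longrightarrow> B i j = B j i" and p: "p \<ge> 1"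
  shows "op_norm N B ^ (2 * p) \<le> trace_pow N B (2 * p)"
proof -
  define T where "T = trace_pow N B (2 * p)"
  have T: "T = (\<Sum>i\<in>{1..N}. \<Sum>j\<in>{1..N}. (mat_pow N B p i j)\<^sup>2)"
    unfolding T_def using trace_pow_even[of N B p] sym by (simp only:) (rule sum.swap)
  have T0: "T \<ge> 0" unfolding T by (intro sum_nonneg) auto
  have main: "L2_set (mat_vec N B x) {1..N} ^ (2 * p) \<le> T" if x: "L2_set x {1..N} \<le> 1" for x
  proof -
    define X where "X k = mat_vec N (mat_pow N B k) x" for k
    define a where "a k = (L2_set (X k) {1..N})\<^sup>2" for k
    have X0: "X 0 i = x i" if "i \<in> {1..N}" for i
      using that by (simp add: X_def mat_vec_def if_distrib[of "\<lambda>t. t * _"] sum.delta cong: if_cong)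
    have XS: "X (Suc k) i = mat_vec N B (X k) i" for k i
      unfolding X_def mat_vec_def mat_pow.simps sum_distrib_left sum_distrib_right
      by (subst sum.swap) (simp add: mult_ac)
    have a0: "a 0 \<le> 1"
    proof -
      have "a 0 = (L2_set x {1..N})\<^sup>2"
        unfolding a_def L2_set_sq using X0 by (intro sum.cong) auto
      then show ?thesis using power_mono[OF x L2_set_nonneg, of 2] by simp
    qed
    have adj: "(\<Sum>i\<in>{1..N}. u i * mat_vec N B v i) = (\<Sum>i\<in>{1..N}. mat_vec N B u i * v i)" for u v
      unfolding mat_vec_def sum_distrib_left sum_distrib_right
      apply (subst sum.swap)
      apply (intro sum.cong refl)
      by (metis (no_types, lifting) mult.assoc mult.commute sym)
    \<comment> \<open>Log-convexity, by the symmetry of \<open>B\<close> and Cauchy--Schwarz.\<close>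
    have conv: "(a (Suc k))\<^sup>2 \<le> a k * a (Suc (Suc k))" for k
    proof -
      have "a (Suc k) = (\<Sum>i\<in>{1..N}. X k i * X (Suc (Suc k)) i)"
        unfolding a_def L2_set_sq XS[of "Suc k"] adj
        by (simp add: XS power2_eq_square)
      then have "a (Suc k) \<le> L2_set (X k) {1..N} * L2_set (X (Suc (Suc k))) {1..N}"
        using sum_mult_le_L2_set by metis
      moreover have "0 \<le> a (Suc k)" by (simp add: a_def)
      ultimately have "(a (Suc k))\<^sup>2 \<le> (L2_set (X k) {1..N} * L2_set (X (Suc (Suc k))) {1..N})\<^sup>2"
        by (intro power_mono)
      then show ?thesis by (simp add: a_def power_mult_distrib)
    qed
    have nn: "0 \<le> a k" for k by (simp add: a_def)
    have step: "a k * a 1 \<le> a (Suc k)" for k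
    proof (induction k)
      case 0 show ?case using mult_right_mono[OF a0 nn[of 1]] by (simp add: One_nat_def)
    next
      case (Suc k)
      show ?case
      proof (cases "a (Suc k) = 0")
        case True then show ?thesis using nn by simp
      next
        case False
        then have pos: "a (Suc k) > 0" using nn[of "Suc k"] by simp
        have "a (Suc k) * (a (Suc k) * a 1) = (a (Suc k))\<^sup>2 * a 1" by (simp add: power2_eq_square)
        also have "\<dots> \<le> a k * a (Suc (Suc k)) * a 1" by (intro mult_right_mono conv nn)
        also have "\<dots> = (a k * a 1) * a (Suc (Suc k))" by simp
        also have "\<dots> \<le> a (Suc k) * a (Suc (Suc k))" by (intro mult_right_mono Suc nn)
        finally show ?thesis using pos by (simp only: mult_le_cancel_left_pos)
      qed
    qed
    have pw: "a 1 ^ Suc k \<le> a (Suc k)" for k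
    proof (induction k)
      case (Suc k)
      have "a 1 ^ Suc (Suc k) = a 1 ^ Suc k * a 1" by simp
      also have "\<dots> \<le> a (Suc k) * a 1" by (intro mult_right_mono Suc nn)
      also have "\<dots> \<le> a (Suc (Suc k))" by (rule step)
      finally show ?case .
    qed (simp add: One_nat_def)
    have "L2_set (X p) {1..N} \<le> sqrt T * L2_set x {1..N}"
      unfolding X_def T by (rule L2_set_mat_vec_le_Frobenius)
    also have "\<dots> \<le> sqrt T" using x T0 by (simp add: mult_left_le)
    finally have "a p \<le> T" unfolding a_def using power_mono[OF _ L2_set_nonneg, of _ _ "sqrt T" 2] T0 by fastforce
    moreover have "a 1 ^ p \<le> a p" using pw[of "p - 1"] p by simp
    moreover have "a 1 = (L2_set (mat_vec N B x) {1..N})\<^sup>2"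
    proof -
      have "mat_vec N B (X 0) i = mat_vec N B x i" for i
        unfolding mat_vec_def[of N B] using X0 by (intro sum.cong) auto
      then show ?thesis using XS[of 0] by (simp add: a_def L2_set_sq One_nat_def)
    qed
    ultimately show ?thesis by (simp add: power_mult)
  qed
  have "op_norm N B \<le> root (2 * p) T"
  proof (rule op_norm_leI)
    fix x assume "L2_set x {1..N} \<le> 1"
    from main[OF this] show "L2_set (mat_vec N B x) {1..N} \<le> root (2 * p) T"
      using p by (metis L2_set_nonneg mult_2 real_root_le_mono real_root_power_cancel
          add_pos_pos less_le_trans zero_less_one)
  qed
  then have "op_norm N B ^ (2 * p) \<le> root (2 * p) T ^ (2 * p)"
    by (intro power_mono op_norm_nonneg)
  also have "\<dots> = T" using p T0 by simp
  finally show ?thesis by (simp add: T_def)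
qed

section \<open>Counting lists with a given equality pattern\<close>

text \<open>
  Two lists have the same pattern if they have the same length and coincidences between their entries
  occur at the same pairs of positions.
\<close>

definition same_pattern :: "'a list \<Rightarrow> 'b list \<Rightarrow> bool" where
  "same_pattern xs ys \<longleftrightarrow> length xs = length ys \<and>
     (\<forall>i<length xs. \<forall>j<length xs. xs ! i = xs ! j \<longleftrightarrow> ys ! i = ys ! j)"

lemma same_pattern_commute: "same_pattern xs ys \<longleftrightarrow> same_pattern ys xs"
  unfolding same_pattern_def by auto

lemma same_pattern_snoc:
  "same_pattern (xs @ [a]) (ys @ [b]) \<longleftrightarrow>
     same_pattern xs ys \<and> (\<forall>i<length xs. xs ! i = a \<longleftrightarrow> ys ! i = b)"
  (is "?L \<longleftrightarrow> ?R")
proof (cases "length xs = length ys")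
  case True
  have old: "(xs @ [a]) ! i = xs ! i" "(ys @ [b]) ! i = ys ! i" if "i < length xs" for i
    using that True by (simp_all add: nth_append)
  have new: "(xs @ [a]) ! length xs = a" "(ys @ [b]) ! length xs = b"
    using True by (simp_all add: nth_append)
  show ?thesis
  proof
    assume L: ?L
    then have *: "(xs @ [a]) ! i = (xs @ [a]) ! j \<longleftrightarrow> (ys @ [b]) ! i = (ys @ [b]) ! j"
      if "i < Suc (length xs)" "j < Suc (length xs)" for i j
      using that by (simp add: same_pattern_def)
    have "xs ! i = xs ! j \<longleftrightarrow> ys ! i = ys ! j" if "i < length xs" "j < length xs" for i j
      using *[of i j] that by (simp add: old)
    moreover have "xs ! i = a \<longleftrightarrow> ys ! i = b" if "i < length xs" for i
      using *[of i "length xs"] that by (simp only: old new less_Suc_eq simp_thms)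
    ultimately show ?R using True by (simp add: same_pattern_def)
  next
    assume R: ?R
    have "(xs @ [a]) ! i = (xs @ [a]) ! j \<longleftrightarrow> (ys @ [b]) ! i = (ys @ [b]) ! j"
      if i: "i < Suc (length xs)" and j: "j < Suc (length xs)" for i j
    proof -
      consider "i < length xs" "j < length xs" | "i < length xs" "j = length xs"
        | "i = length xs" "j < length xs" | "i = length xs" "j = length xs"
        using i j by linarith
      then show ?thesis
      proof cases
        case 1 then show ?thesis using R by (simp add: old same_pattern_def)
      next
        case 2 then show ?thesis using R by (simp only: old new)
      next
        case 3 then show ?thesis using R by (simp only: old new) (metis)
      qed simp
    qed
    then show ?L using True by (simp add: same_pattern_def)
  qed
qed (simp add: same_pattern_def)

lemma same_pattern_card_set:
  assumes "same_pattern xs ys"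
  shows "card (set xs) = card (set ys)"
proof -
  define f where "f x = ys ! (SOME i. i < length xs \<and> xs ! i = x)" for x
  have f: "f (xs ! i) = ys ! i" if "i < length xs" for i
  proof -
    have "(SOME k. k < length xs \<and> xs ! k = xs ! i) < length xs \<and> xs ! (SOME k. k < length xs \<and> xs ! k = xs ! i) = xs ! i"
      by (rule someI[of "\<lambda>k. k < length xs \<and> xs ! k = xs ! i" i]) (use that in simp)
    then show ?thesis using assms that unfolding f_def same_pattern_def by blast
  qed
  have len: "length ys = length xs" using assms by (simp add: same_pattern_def)
  have "bij_betw f (set xs) (set ys)"
    unfolding bij_betw_def
  proof
    show "inj_on f (set xs)"
    proof (rule inj_onI)
      fix x y assume "x \<in> set xs" "y \<in> set xs" "f x = f y"
      then obtain i j where "i < length xs" "j < length xs" "x = xs ! i" "y = xs ! j"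
        by (metis in_set_conv_nth)
      then show "x = y" using f \<open>f x = f y\<close> assms by (simp add: same_pattern_def)
    qed
    show "f ` set xs = set ys"
      unfolding set_conv_nth using f len by (force simp: image_iff)
  qed
  then show ?thesis by (rule bij_betw_same_card)
qed

text \<open>
  A walk on the vertices \<open>{1..N}\<close>, as the list of visited vertices; \<open>nb v\<close> is the set of
  vertices that may follow \<open>v\<close>.
\<close>

definition walk_list :: "(nat \<Rightarrow> nat set) \<Rightarrow> nat \<Rightarrow> nat list \<Rightarrow> bool" where
  "walk_list nb N w \<longleftrightarrow> set w \<subseteq> {1..N} \<and> (\<forall>i. Suc i < length w \<longrightarrow> w ! Suc i \<in> nb (w ! i))"

lemma walk_list_snoc:
  assumes "walk_list nb N (w @ [a])"
  shows "walk_list nb N w" and "w \<noteq> [] \<Longrightarrow> a \<in> nb (last w)"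
proof -
  show "walk_list nb N w"
    using assms unfolding walk_list_def
    by (auto simp: nth_append) (metis Suc_lessD less_SucI not_less_eq)
  assume "w \<noteq> []"
  then have "Suc (length w - 1) < length (w @ [a])" by simp
  then have "(w @ [a]) ! Suc (length w - 1) \<in> nb ((w @ [a]) ! (length w - 1))"
    using assms unfolding walk_list_def by blast
  then show "a \<in> nb (last w)" using \<open>w \<noteq> []\<close> by (simp add: nth_append last_conv_nth)
qed

lemma finite_walk_lists: "finite {w. walk_list nb N w \<and> length w = n}"
  by (rule finite_subset[OF _ finite_lists_length_eq[of "{1..N}" n]]) (auto simp: walk_list_def)

lemma finite_walk_pattern: "finite {w. walk_list nb N w \<and> same_pattern w u}"
  by (rule finite_subset[OF _ finite_walk_lists[of nb N "length u"]]) (auto simp: same_pattern_def)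

text \<open>
  Reading a walk from left to right, an entry that repeats an earlier one is determined by the pattern,
  and a new entry is one of at most \<open>D\<close> neighbours of its predecessor. Only the first entry is
  chosen among all \<open>N\<close> vertices.
\<close>

lemma card_walks_with_pattern:
  fixes u :: "'a list"
  assumes nb: "\<And>v. v \<in> {1..N} \<Longrightarrow> finite (nb v) \<and> card (nb v) \<le> D"
    and "u \<noteq> []"
  shows "card {w. walk_list nb N w \<and> same_pattern w u} \<le> N * D ^ (card (set u) - 1)"
  using assms(2)
proof (induction u rule: rev_nonempty_induct)
  case (single b)
  have "{w. walk_list nb N w \<and> same_pattern w [b]} \<subseteq> (\<lambda>a. [a]) ` {1..N}"
    by (auto simp: walk_list_def same_pattern_def length_Suc_conv)
  from surj_card_le[OF _ this] show ?case by simp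
next
  case (snoc b u)
  let ?S = "{w. walk_list nb N w \<and> same_pattern w u}"
  let ?T = "{w. walk_list nb N w \<and> same_pattern w (u @ [b])}"
  have T: "\<exists>w' a. w = w' @ [a] \<and> w' \<in> ?S \<and> a \<in> nb (last w') \<and> last w' \<in> {1..N}
             \<and> (\<forall>i<length u. w' ! i = a \<longleftrightarrow> u ! i = b)" if "w \<in> ?T" for w
  proof -
    have "w \<noteq> []" using that by (auto simp: same_pattern_def)
    then obtain w' a where w: "w = w' @ [a]" by (metis append_butlast_last_id)
    then have sp: "same_pattern w' u" "\<forall>i<length w'. w' ! i = a \<longleftrightarrow> u ! i = b"
      using that by (auto simp: same_pattern_snoc)
    then have len: "length w' = length u" by (simp add: same_pattern_def)
    then have "w' \<noteq> []" using snoc.hyps by auto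
    then have "last w' \<in> {1..N}" using that w last_in_set[of w'] unfolding walk_list_def by fastforce
    moreover have "walk_list nb N w'" "a \<in> nb (last w')"
      using that w walk_list_snoc[of nb N w' a] \<open>w' \<noteq> []\<close> by simp_all
    ultimately show ?thesis using w sp len by (intro exI[of _ w'] exI[of _ a]) simp
  qed
  show ?case
  proof (cases "b \<in> set u")
    case True
    then obtain i where i: "i < length u" "u ! i = b" by (auto simp: in_set_conv_nth)
    have "?T \<subseteq> (\<lambda>w. w @ [w ! i]) ` ?S"
    proof
      fix w assume "w \<in> ?T"
      from T[OF this] i show "w \<in> (\<lambda>w. w @ [w ! i]) ` ?S" by auto
    qed
    then have "card ?T \<le> card ?S" by (rule surj_card_le[OF finite_walk_pattern])
    also have "\<dots> \<le> N * D ^ (card (set u) - 1)" by (rule snoc.IH)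
    also have "set u = set (u @ [b])" using True by auto
    finally show ?thesis .
  next
    case False
    have finS: "finite {w\<in>?S. last w \<in> {1..N}}"
      by (rule finite_subset[OF _ finite_walk_pattern[of nb N u]]) blast
    have "?T \<subseteq> (\<Union>w\<in>{w\<in>?S. last w \<in> {1..N}}. (\<lambda>a. w @ [a]) ` nb (last w))"
      using T by blast
    then have "card ?T \<le> card (\<Union>w\<in>{w\<in>?S. last w \<in> {1..N}}. (\<lambda>a. w @ [a]) ` nb (last w))"
      using nb finS by (intro card_mono finite_UN_I finite_imageI) auto
    also have "\<dots> \<le> (\<Sum>w\<in>{w\<in>?S. last w \<in> {1..N}}. card ((\<lambda>a. w @ [a]) ` nb (last w)))"
      by (rule card_UN_le[OF finS])
    also have "\<dots> \<le> (\<Sum>w\<in>{w\<in>?S. last w \<in> {1..N}}. D)"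
    proof (intro sum_mono)
      fix w assume "w \<in> {w\<in>?S. last w \<in> {1..N}}"
      then have "finite (nb (last w)) \<and> card (nb (last w)) \<le> D" using nb by blast
      then show "card ((\<lambda>a. w @ [a]) ` nb (last w)) \<le> D" using card_image_le order_trans by blast
    qed
    also have "\<dots> \<le> card ?S * D"
    proof -
      have "card {w\<in>?S. last w \<in> {1..N}} \<le> card ?S"
        by (rule card_mono[OF finite_walk_pattern]) blast
      then show ?thesis by simp
    qed
    also have "\<dots> \<le> N * D ^ (card (set u) - 1) * D" using snoc.IH by simp
    also have "\<dots> = N * D ^ (card (set (u @ [b])) - 1)"
    proof -
      have "card (set u) > 0" using snoc.hyps by (simp add: card_gt_0_iff)
      then obtain c where "card (set u) = Suc c" by (metis gr0_implies_Suc)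
      then show ?thesis using False by simp
    qed
    finally show ?thesis .
  qed
qed

lemma finite_lists_with_pattern: "finite {u. set u \<subseteq> {1..r::nat} \<and> same_pattern u w}"
  by (rule finite_subset[OF _ finite_lists_length_eq[of "{1..r}" "length w"]]) (auto simp: same_pattern_def)

text \<open>
  Without the adjacency constraint, each new entry can be any of the \<open>r\<close> values not used so far.
  There are at least \<open>D\<close> of them, because fewer than \<open>length w\<close> values have been used and
  \<open>D + length w - 1 \<le> r\<close>.
\<close>

lemma card_lists_with_pattern:
  fixes w :: "'a list"
  assumes "w \<noteq> []" and "D + length w \<le> Suc r"
  shows "r * D ^ (card (set w) - 1) \<le> card {u. set u \<subseteq> {1..r::nat} \<and> same_pattern u w}"
  using assms
proof (induction w rule: rev_nonempty_induct)
  case (single b)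
  have "(\<lambda>a. [a]) ` {1..r} \<subseteq> {u. set u \<subseteq> {1..r} \<and> same_pattern u [b]}"
    by (auto simp: same_pattern_def)
  from card_mono[OF finite_lists_with_pattern this] show ?case
    by (simp add: card_image inj_on_def)
next
  case (snoc b w)
  let ?S = "{u. set u \<subseteq> {1..r} \<and> same_pattern u w}"
  let ?T = "{u. set u \<subseteq> {1..r} \<and> same_pattern u (w @ [b])}"
  have IH: "r * D ^ (card (set w) - 1) \<le> card ?S" using snoc by simp
  show ?case
  proof (cases "b \<in> set w")
    case True
    then obtain i where i: "i < length w" "w ! i = b" by (auto simp: in_set_conv_nth)
    have "(\<lambda>u. u @ [u ! i]) ` ?S \<subseteq> ?T"
    proof
      fix v assume "v \<in> (\<lambda>u. u @ [u ! i]) ` ?S"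
      then obtain u where u: "v = u @ [u ! i]" "set u \<subseteq> {1..r}" "same_pattern u w" by auto
      then have "length u = length w" by (simp add: same_pattern_def)
      then have "\<forall>k<length u. u ! k = u ! i \<longleftrightarrow> w ! k = b" "u ! i \<in> {1..r}"
        using u i by (auto simp: same_pattern_def subset_iff)
      then show "v \<in> ?T" using u by (simp add: same_pattern_snoc)
    qed
    from card_mono[OF finite_lists_with_pattern this] have "card ?S \<le> card ?T"
      by (simp add: card_image inj_on_def)
    moreover have "set w = set (w @ [b])" using True by auto
    ultimately show ?thesis using IH by simp
  next
    case False
    let ?U = "\<Union>u\<in>?S. (\<lambda>a. u @ [a]) ` ({1..r} - set u)"
    have "?U \<subseteq> ?T"
    proof
      fix v assume "v \<in> ?U"
      then obtain u a where u: "v = u @ [a]" "set u \<subseteq> {1..r}" "same_pattern u w" "a \<in> {1..r}" "a \<notin> set u"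
        by auto
      then have "length u = length w" by (simp add: same_pattern_def)
      then have "\<forall>i<length u. u ! i = a \<longleftrightarrow> w ! i = b" using u(5) False by (metis nth_mem)
      then show "v \<in> ?T" using u by (auto simp: same_pattern_snoc)
    qed
    then have 1: "card ?U \<le> card ?T" by (rule card_mono[OF finite_lists_with_pattern])
    have "card ?U = (\<Sum>u\<in>?S. card ((\<lambda>a. u @ [a]) ` ({1..r} - set u)))"
      by (rule card_UN_disjoint) (auto intro: finite_lists_with_pattern)
    moreover have "(\<Sum>u\<in>?S. card ((\<lambda>a. u @ [a]) ` ({1..r} - set u))) \<ge> (\<Sum>u\<in>?S. D)"
    proof (intro sum_mono)
      fix u assume u: "u \<in> ?S"
      have "card ((\<lambda>a. u @ [a]) ` ({1..r} - set u)) = card ({1..r} - set u)"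
        by (simp add: card_image inj_on_def)
      also have "\<dots> = r - card (set u)" using u by (subst card_Diff_subset) auto
      also have "\<dots> \<ge> r - length u" by (simp add: card_length diff_le_mono2)
      finally show "D \<le> card ((\<lambda>a. u @ [a]) ` ({1..r} - set u))"
        using u snoc.prems by (simp add: same_pattern_def)
    qed
    ultimately have "card ?S * D \<le> card ?T" using 1 by simp
    moreover have "r * D ^ (card (set w) - 1) * D \<le> card ?S * D" using IH by simp
    moreover have "r * D ^ (card (set w) - 1) * D = r * D ^ (card (set (w @ [b])) - 1)"
    proof -
      have "card (set w) > 0" using snoc.hyps by (simp add: card_gt_0_iff)
      then obtain c where "card (set w) = Suc c" by (metis gr0_implies_Suc)
      then show ?thesis using False by simp
    qed
    ultimately show ?thesis by linarith
  qed
qed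

text \<open>
  The dimension reduction. For a pattern with \<open>m\<close> distinct entries there are at most
  \<open>N * D ^ (m - 1)\<close> walks in the graph and at least \<open>r * D ^ (m - 1)\<close> lists over \<open>{1..r}\<close>, and
  \<open>\<Phi>\<close> takes the same value on all of them.
\<close>

lemma sum_walks_le_sum_lists:
  fixes \<Phi> :: "nat list \<Rightarrow> real"
  assumes nb: "\<And>v. v \<in> {1..N} \<Longrightarrow> finite (nb v) \<and> card (nb v) \<le> D"
    and D: "D > 0" and r: "D + n \<le> r"
    and inv: "\<And>u w. same_pattern u w \<Longrightarrow> \<Phi> u = \<Phi> w"
    and nonneg: "\<And>w. \<Phi> w \<ge> 0"
  shows "real r * (\<Sum>w | walk_list nb N w \<and> length w = Suc n. \<Phi> w)
       \<le> real N * (\<Sum>u | set u \<subseteq> {1..r} \<and> length u = Suc n. \<Phi> u)"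
proof -
  let ?W = "{w. walk_list nb N w \<and> length w = Suc n}"
  let ?L = "{u. set u \<subseteq> {1..r} \<and> length u = Suc n}"
  have finW: "finite ?W" by (rule finite_walk_lists)
  have finL: "finite ?L" by (rule finite_lists_length_eq) simp
  define q where "q u = real D ^ (card (set u) - 1)" for u :: "nat list"
  have q: "q u > 0" for u using D by (simp add: q_def)
  \<comment> \<open>Both bounds are divided by \<open>q\<close>, which depends on the pattern only, and combined by double counting.\<close>
  have up: "real r * \<Phi> w \<le> (\<Sum>u | u \<in> ?L \<and> same_pattern u w. \<Phi> w / q w)" if "w \<in> ?W" for w :: "nat list"
  proof -
    define S where "S = {u. u \<in> ?L \<and> same_pattern u w}"
    have len: "length w = Suc n" using that by blast
    have "S = {u. set u \<subseteq> {1..r} \<and> same_pattern u w}"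
      unfolding S_def using len by (auto simp: same_pattern_def)
    moreover have "w \<noteq> []" "D + length w \<le> Suc r" using len r by auto
    ultimately have "r * D ^ (card (set w) - 1) \<le> card S"
      using card_lists_with_pattern[of w D r] by simp
    then have "real r * q w \<le> real (card S)"
      unfolding q_def of_nat_power[symmetric] of_nat_mult[symmetric] of_nat_le_iff .
    moreover have "0 \<le> \<Phi> w / q w" using q[of w] nonneg[of w] by simp
    ultimately have "real r * q w * (\<Phi> w / q w) \<le> real (card S) * (\<Phi> w / q w)"
      by (rule mult_right_mono)
    moreover have "real r * q w * (\<Phi> w / q w) = real r * \<Phi> w" using q[of w] by simp
    moreover have "real (card S) * (\<Phi> w / q w) = (\<Sum>u\<in>S. \<Phi> w / q w)" by (rule sum_constant[symmetric])
    ultimately show ?thesis unfolding S_def by (simp only:)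
  qed
  have down: "(\<Sum>w | w \<in> ?W \<and> same_pattern u w. \<Phi> w / q w) \<le> real N * \<Phi> u" if "u \<in> ?L" for u :: "nat list"
  proof -
    define S where "S = {w. w \<in> ?W \<and> same_pattern u w}"
    have "length u = Suc n" using that by blast
    then have "S = {w. walk_list nb N w \<and> same_pattern w u}"
      unfolding S_def same_pattern_commute[of u] by (auto simp: same_pattern_def)
    moreover have "u \<noteq> []" using that by auto
    ultimately have "card S \<le> N * D ^ (card (set u) - 1)"
      using card_walks_with_pattern[of N nb D u, OF nb] by simp
    then have card: "real (card S) \<le> real N * q u"
      unfolding q_def of_nat_power[symmetric] of_nat_mult[symmetric] of_nat_le_iff .
    have "\<Phi> w / q w = \<Phi> u / q u" if "w \<in> S" for w
      using that inv[of u w] same_pattern_card_set[of u w] by (simp add: q_def S_def)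
    then have "(\<Sum>w\<in>S. \<Phi> w / q w) = (\<Sum>w\<in>S. \<Phi> u / q u)" by (rule sum.cong[OF refl])
    also have "\<dots> = real (card S) * (\<Phi> u / q u)" by (rule sum_constant)
    finally have "(\<Sum>w\<in>S. \<Phi> w / q w) = real (card S) * (\<Phi> u / q u)" .
    moreover have "real (card S) * (\<Phi> u / q u) \<le> real N * q u * (\<Phi> u / q u)"
      by (rule mult_right_mono[OF card]) (use q[of u] nonneg[of u] in simp)
    moreover have "real N * q u * (\<Phi> u / q u) = real N * \<Phi> u" using q[of u] by simp
    ultimately show ?thesis unfolding S_def by (simp only:)
  qed
  have "real r * (\<Sum>w\<in>?W. \<Phi> w) \<le> (\<Sum>w\<in>?W. \<Sum>u | u \<in> ?L \<and> same_pattern u w. \<Phi> w / q w)"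
    unfolding sum_distrib_left by (intro sum_mono up)
  also have "\<dots> = (\<Sum>u\<in>?L. \<Sum>w | w \<in> ?W \<and> same_pattern u w. \<Phi> w / q w)"
    by (rule sum.swap_restrict[OF finW finL])
  also have "\<dots> \<le> (\<Sum>u\<in>?L. real N * \<Phi> u)" by (intro sum_mono down)
  finally show ?thesis by (simp add: sum_distrib_left)
qed

section \<open>Closed walks and traces of random matrices\<close>

text \<open>
  The edge used in step \<open>k\<close> of a walk, as a pair whose first component is the smaller one; \<open>edge_mult w e\<close> is
  the number of steps of \<open>w\<close> along \<open>e\<close>.
\<close>

definition edge :: "nat list \<Rightarrow> nat \<Rightarrow> nat \<times> nat" where
  "edge w k = (min (w ! k) (w ! Suc k), max (w ! k) (w ! Suc k))"

definition edge_set :: "nat list \<Rightarrow> (nat \<times> nat) set" where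
  "edge_set w = edge w ` {..<length w - 1}"

definition edge_mult :: "nat list \<Rightarrow> nat \<times> nat \<Rightarrow> nat" where
  "edge_mult w e = card {k \<in> {..<length w - 1}. edge w k = e}"

text \<open>
  For a symmetric matrix with independent entries that all have the moments \<open>\<mu>\<close>, this is the expected
  contribution of \<open>w\<close> to the trace of a power: zero unless the walk is closed, and
  otherwise the product over the used edges of the moments given by their multiplicities.
\<close>

definition walk_weight :: "(nat \<Rightarrow> real) \<Rightarrow> nat list \<Rightarrow> real" where
  "walk_weight \<mu> w = (if w ! 0 = w ! (length w - 1) then \<Prod>e\<in>edge_set w. \<mu> (edge_mult w e) else 0)"

lemma edge_eq_iff:
  "edge w k = edge w l \<longleftrightarrow>
     (w ! k = w ! l \<and> w ! Suc k = w ! Suc l) \<or> (w ! k = w ! Suc l \<and> w ! Suc k = w ! l)"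
  unfolding edge_def by (auto simp: min_def max_def)

text \<open>
  A product over the image of \<open>f\<close> that involves only the sizes of the fibres depends on \<open>f\<close>
  only through its kernel.
\<close>

lemma prod_image_card_cong:
  assumes "finite A" and ker: "\<And>k l. k \<in> A \<Longrightarrow> l \<in> A \<Longrightarrow> f k = f l \<longleftrightarrow> g k = g l"
  shows "(\<Prod>e\<in>f ` A. h (card {k \<in> A. f k = e})) = (\<Prod>e\<in>g ` A. h (card {k \<in> A. g k = e}))"
proof -
  define F where "F e = g (inv_into A f e)" for e
  have F: "F (f k) = g k" if "k \<in> A" for k
    unfolding F_def using ker[of "inv_into A f (f k)" k] that
    by (simp add: f_inv_into_f inv_into_into)
  have "inj_on F (f ` A)"
    by (auto simp: inj_on_def F ker)
  then have bij: "bij_betw F (f ` A) (g ` A)"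
    unfolding bij_betw_def by (auto simp: F image_image cong: image_cong)
  have "{k \<in> A. f k = f l} = {k \<in> A. g k = F (f l)}" if "l \<in> A" for l
    using that ker by (auto simp: F)
  then have "(\<Prod>e\<in>f ` A. h (card {k \<in> A. f k = e})) = (\<Prod>e\<in>f ` A. h (card {k \<in> A. g k = F e}))"
    by (intro prod.cong refl) auto
  also have "\<dots> = (\<Prod>e\<in>g ` A. h (card {k \<in> A. g k = e}))"
    by (rule prod.reindex_bij_betw[OF bij])
  finally show ?thesis .
qed

text \<open>
  The weight depends only on the pattern, because the pattern determines which steps use the same edge.
\<close>

lemma walk_weight_same_pattern:
  assumes "same_pattern u w"
  shows "walk_weight \<mu> u = walk_weight \<mu> w"
proof (cases "u = []")
  case True
  then show ?thesis using assms by (simp add: same_pattern_def)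
next
  case False
  have len: "length u = length w" and
    pat: "\<And>i j. i < length w \<Longrightarrow> j < length w \<Longrightarrow> u ! i = u ! j \<longleftrightarrow> w ! i = w ! j"
    using assms by (auto simp: same_pattern_def)
  have "u ! 0 = u ! (length u - 1) \<longleftrightarrow> w ! 0 = w ! (length w - 1)"
    using pat[of 0 "length w - 1"] len False by (cases w) auto
  moreover have "edge u k = edge u l \<longleftrightarrow> edge w k = edge w l"
    if "k \<in> {..<length w - 1}" "l \<in> {..<length w - 1}" for k l
  proof -
    have "k < length w" "l < length w" "Suc k < length w" "Suc l < length w" using that by auto
    then show ?thesis by (simp only: edge_eq_iff pat)
  qed
  then have "(\<Prod>e\<in>edge_set u. \<mu> (edge_mult u e)) = (\<Prod>e\<in>edge_set w. \<mu> (edge_mult w e))"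
    unfolding edge_set_def edge_mult_def len by (intro prod_image_card_cong) auto
  ultimately show ?thesis by (simp add: walk_weight_def)
qed

lemma walk_weight_nonneg: "(\<And>m. 0 \<le> \<mu> m) \<Longrightarrow> 0 \<le> walk_weight \<mu> w"
  by (auto simp: walk_weight_def intro: prod_nonneg)

lemma finite_edge_set: "finite (edge_set w)"
  by (simp add: edge_set_def)

lemma prod_steps_eq_prod_edges:
  fixes h :: "nat \<times> nat \<Rightarrow> 'a::comm_monoid_mult"
  shows "(\<Prod>k<length w - 1. h (edge w k)) = (\<Prod>e\<in>edge_set w. h e ^ edge_mult w e)"
proof -
  have "(\<Prod>k<length w - 1. h (edge w k))
      = (\<Prod>e\<in>edge_set w. \<Prod>k\<in>{k \<in> {..<length w - 1}. edge w k = e}. h (edge w k))"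
    unfolding edge_set_def by (rule prod.image_gen) simp
  also have "\<dots> = (\<Prod>e\<in>edge_set w. h e ^ edge_mult w e)"
  proof (intro prod.cong refl)
    fix e
    have "(\<Prod>k\<in>{k \<in> {..<length w - 1}. edge w k = e}. h (edge w k))
        = (\<Prod>k\<in>{k \<in> {..<length w - 1}. edge w k = e}. h e)"
      by (intro prod.cong refl) simp
    then show "(\<Prod>k\<in>{k \<in> {..<length w - 1}. edge w k = e}. h (edge w k)) = h e ^ edge_mult w e"
      by (simp only: prod_constant edge_mult_def)
  qed
  finally show ?thesis .
qed

lemma sum_edge_mult: "(\<Sum>e\<in>edge_set w. edge_mult w e) = length w - 1"
proof -
  have "(\<Sum>k<length w - 1. 1 :: nat) = (\<Sum>e\<in>edge_set w. \<Sum>k\<in>{k \<in> {..<length w - 1}. edge w k = e}. 1)"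
    unfolding edge_set_def by (rule sum.image_gen) simp
  then show ?thesis by (simp add: edge_mult_def)
qed

lemma edge_mult_eq_0: "e \<notin> edge_set w \<Longrightarrow> edge_mult w e = 0"
  by (auto simp: edge_set_def edge_mult_def)

lemma sum_lists_Suc:
  fixes f :: "'b list \<Rightarrow> 'a::comm_monoid_add"
  assumes "finite A"
  shows "(\<Sum>w | set w \<subseteq> A \<and> length w = Suc n. f w)
       = (\<Sum>a\<in>A. \<Sum>w | set w \<subseteq> A \<and> length w = n. f (a # w))"
proof -
  have fin: "finite {w. set w \<subseteq> A \<and> length w = n}" by (rule finite_lists_length_eq[OF assms])
  have "(\<Sum>w | set w \<subseteq> A \<and> length w = Suc n. f w)
      = (\<Sum>z\<in>{w. set w \<subseteq> A \<and> length w = n} \<times> A. f (snd z # fst z))"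
    unfolding lists_length_Suc_eq by (subst sum.reindex) (auto simp: inj_on_def case_prod_unfold)
  also have "\<dots> = (\<Sum>w | set w \<subseteq> A \<and> length w = n. \<Sum>a\<in>A. f (a # w))"
    by (simp only: sum.cartesian_product' fst_conv snd_conv)
  also have "\<dots> = (\<Sum>a\<in>A. \<Sum>w | set w \<subseteq> A \<and> length w = n. f (a # w))"
    by (rule sum.swap)
  finally show ?thesis .
qed

lemma mat_pow_eq_sum_walks:
  assumes "i \<in> {1..N}"
  shows "mat_pow N B n i j = (\<Sum>w | set w \<subseteq> {1..N} \<and> length w = n.
           if (i # w) ! n = j then \<Prod>k<n. B ((i # w) ! k) ((i # w) ! Suc k) else 0)"
  using assms
proof (induction n arbitrary: i)
  case 0
  have "{w. set w \<subseteq> {1..N} \<and> length w = 0} = {[]}" by auto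
  then show ?case by simp
next
  case (Suc n)
  have "mat_pow N B (Suc n) i j = (\<Sum>l\<in>{1..N}. B i l * (\<Sum>w | set w \<subseteq> {1..N} \<and> length w = n.
           if (l # w) ! n = j then \<Prod>k<n. B ((l # w) ! k) ((l # w) ! Suc k) else 0))"
    unfolding mat_pow.simps by (intro sum.cong refl arg_cong2[where f = "(*)"] Suc.IH)
  also have "\<dots> = (\<Sum>l\<in>{1..N}. \<Sum>w | set w \<subseteq> {1..N} \<and> length w = n.
           if (i # l # w) ! Suc n = j
           then \<Prod>k<Suc n. B ((i # l # w) ! k) ((i # l # w) ! Suc k) else 0)"
    unfolding sum_distrib_left prod.lessThan_Suc_shift by (intro sum.cong refl) simp
  finally show ?case by (simp only: sum_lists_Suc[OF finite_atLeastAtMost])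
qed

lemma trace_pow_eq_sum_walks:
  "trace_pow N B n = (\<Sum>w | set w \<subseteq> {1..N} \<and> length w = Suc n.
      if w ! 0 = w ! n then \<Prod>k<n. B (w ! k) (w ! Suc k) else 0)"
  unfolding trace_pow_def sum_lists_Suc[OF finite_atLeastAtMost]
proof (intro sum.cong refl)
  fix i assume "i \<in> {1..N}"
  have eq: "((i # w) ! 0 = (i # w) ! n) \<longleftrightarrow> ((i # w) ! n = i)" for w by auto
  show "mat_pow N B n i i = (\<Sum>w | set w \<subseteq> {1..N} \<and> length w = n.
      if (i # w) ! 0 = (i # w) ! n then \<Prod>k<n. B ((i # w) ! k) ((i # w) ! Suc k) else 0)"
    unfolding mat_pow_eq_sum_walks[OF \<open>i \<in> {1..N}\<close>] eq ..
qed

text \<open>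
  Expectation under the product of \<open>I\<close> copies of a probability distribution on a finite set \<open>K\<close>
  with weights \<open>p\<close>, written as a finite sum. A sample \<open>\<phi>\<close> assigns an element of \<open>K\<close> to each index.
\<close>

definition prod_expect :: "'e set \<Rightarrow> 'k set \<Rightarrow> ('k \<Rightarrow> real) \<Rightarrow> (('e \<Rightarrow> 'k) \<Rightarrow> real) \<Rightarrow> real" where
  "prod_expect I K p F = (\<Sum>\<phi>\<in>PiE I (\<lambda>_. K). (\<Prod>e\<in>I. p (\<phi> e)) * F \<phi>)"

lemma prod_expect_prod:
  assumes "finite I" "finite K"
  shows "prod_expect I K p (\<lambda>\<phi>. \<Prod>e\<in>I. f e (\<phi> e)) = (\<Prod>e\<in>I. \<Sum>k\<in>K. p k * f e k)"
  unfolding prod_expect_def using assms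
  by (subst prod_sum_PiE) (auto simp: prod.distrib)

lemma prod_expect_sum:
  "prod_expect I K p (\<lambda>\<phi>. \<Sum>x\<in>S. F x \<phi>) = (\<Sum>x\<in>S. prod_expect I K p (F x))"
  unfolding prod_expect_def sum_distrib_left by (rule sum.swap)

lemma prod_expect_cmult: "prod_expect I K p (\<lambda>\<phi>. c * F \<phi>) = c * prod_expect I K p F"
  unfolding prod_expect_def sum_distrib_left by (simp add: mult_ac)

lemma prod_expect_mono:
  assumes "\<And>k. k \<in> K \<Longrightarrow> 0 \<le> p k" and "\<And>\<phi>. F \<phi> \<le> H \<phi>"
  shows "prod_expect I K p F \<le> prod_expect I K p H"
  unfolding prod_expect_def
  by (intro sum_mono mult_left_mono assms prod_nonneg ballI) (auto simp: PiE_iff)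

text \<open>
  The symmetric matrix with entries \<open>y (\<phi> e)\<close>, indexed by the pairs \<open>e\<close> on and above the diagonal.
  The diagonal need not vanish here.
\<close>

definition upper_pairs :: "nat \<Rightarrow> (nat \<times> nat) set" where
  "upper_pairs r = {(i, j). i \<in> {1..r} \<and> j \<in> {1..r} \<and> i \<le> j}"

definition sym_matrix :: "('k \<Rightarrow> real) \<Rightarrow> (nat \<times> nat \<Rightarrow> 'k) \<Rightarrow> nat \<Rightarrow> nat \<Rightarrow> real" where
  "sym_matrix y \<phi> i j = y (\<phi> (min i j, max i j))"

lemma finite_upper_pairs: "finite (upper_pairs r)"
  by (rule finite_subset[of _ "{1..r} \<times> {1..r}"]) (auto simp: upper_pairs_def)

lemma edge_set_subset_upper_pairs:
  assumes "set w \<subseteq> {1..r}"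
  shows "edge_set w \<subseteq> upper_pairs r"
proof
  fix e assume "e \<in> edge_set w"
  then obtain k where k: "k < length w - 1" "e = edge w k" by (auto simp: edge_set_def)
  then have "w ! k \<in> set w" "w ! Suc k \<in> set w" by simp_all
  then have "w ! k \<in> {1..r}" "w ! Suc k \<in> {1..r}" using assms by blast+
  then show "e \<in> upper_pairs r" using k by (auto simp: edge_def upper_pairs_def)
qed

lemma prod_expect_trace_pow:
  assumes "finite K" and total: "(\<Sum>k\<in>K. p k) = 1"
  shows "prod_expect (upper_pairs r) K p (\<lambda>\<phi>. trace_pow r (sym_matrix y \<phi>) n)
       = (\<Sum>w | set w \<subseteq> {1..r} \<and> length w = Suc n. walk_weight (\<lambda>m. \<Sum>k\<in>K. p k * y k ^ m) w)"
  unfolding trace_pow_eq_sum_walks prod_expect_sum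
proof (intro sum.cong refl)
  fix w assume w: "w \<in> {w. set w \<subseteq> {1..r} \<and> length w = Suc n}"
  have sub: "edge_set w \<subseteq> upper_pairs r" using w edge_set_subset_upper_pairs by blast
  have len: "length w - 1 = n" using w by (simp add: One_nat_def)
  let ?\<mu> = "\<lambda>m. \<Sum>k\<in>K. p k * y k ^ m"
  have "(\<Prod>k<n. sym_matrix y \<phi> (w ! k) (w ! Suc k)) = (\<Prod>e\<in>upper_pairs r. y (\<phi> e) ^ edge_mult w e)" for \<phi>
  proof -
    have "(\<Prod>k<n. sym_matrix y \<phi> (w ! k) (w ! Suc k)) = (\<Prod>e\<in>edge_set w. y (\<phi> e) ^ edge_mult w e)"
      using prod_steps_eq_prod_edges[of "\<lambda>e. y (\<phi> e)" w] by (simp add: len edge_def sym_matrix_def)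
    also have "\<dots> = (\<Prod>e\<in>upper_pairs r. y (\<phi> e) ^ edge_mult w e)"
      by (rule prod.mono_neutral_left[OF finite_upper_pairs sub]) (auto simp: edge_mult_eq_0)
    finally show ?thesis .
  qed
  moreover have "prod_expect (upper_pairs r) K p (\<lambda>\<phi>. \<Prod>e\<in>upper_pairs r. y (\<phi> e) ^ edge_mult w e)
      = (\<Prod>e\<in>upper_pairs r. ?\<mu> (edge_mult w e))"
    by (rule prod_expect_prod[OF finite_upper_pairs \<open>finite K\<close>])
  moreover have "(\<Prod>e\<in>upper_pairs r. ?\<mu> (edge_mult w e)) = (\<Prod>e\<in>edge_set w. ?\<mu> (edge_mult w e))"
    by (rule prod.mono_neutral_right[OF finite_upper_pairs sub]) (auto simp: edge_mult_eq_0 total)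
  ultimately show "prod_expect (upper_pairs r) K p
        (\<lambda>\<phi>. if w ! 0 = w ! n then \<Prod>k<n. sym_matrix y \<phi> (w ! k) (w ! Suc k) else 0)
      = walk_weight ?\<mu> w"
    by (simp add: walk_weight_def len prod_expect_def)
qed

section \<open>A subgaussian law with large moments\<close>

text \<open>
  A centred law that dominates the moments of all subgaussian variables, including the odd moments,
  up to order \<open>K\<close> and up to a scaling. It has mass \<open>8\<^sup>-\<^sup>k\<close> at \<open>sqrt k\<close> for \<open>1 \<le> k \<le> K\<close>; the
  mass at \<open>-1\<close> makes the mean zero, and the remaining mass is put at \<open>0\<close>. The indices
  \<open>0..K\<close> stand for the points \<open>sqrt k\<close>, the index \<open>Suc K\<close> for the point \<open>-1\<close>.
\<close>

definition law_point :: "nat \<Rightarrow> nat \<Rightarrow> real" where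
  "law_point K k = (if k \<le> K then sqrt (real k) else -1)"

definition law_weight :: "nat \<Rightarrow> nat \<Rightarrow> real" where
  "law_weight K k =
     (if k = 0 then 1 - (\<Sum>k=1..K. (1/8)^k * (1 + sqrt (real k)))
      else if k \<le> K then (1/8)^k
      else (\<Sum>k=1..K. (1/8)^k * sqrt (real k)))"

definition law_moment :: "nat \<Rightarrow> nat \<Rightarrow> real" where
  "law_moment K m = (\<Sum>k\<le>Suc K. law_weight K k * law_point K k ^ m)"

lemma sum_half_powers: "(\<Sum>k=1..K. (1/2::real)^k) = 1 - (1/2)^K"
  by (induction K) (auto simp: One_nat_def)

lemma sum_quarter_powers: "(\<Sum>k=1..K. (1/4::real)^k) = (1 - (1/4)^K) / 3"
proof (induction K)
  case (Suc K)
  have "(\<Sum>k=1..Suc K. (1/4::real)^k) = (\<Sum>k=1..K. (1/4::real)^k) + (1/4)^Suc K" by simp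
  then show ?case unfolding Suc by simp
qed simp

lemma sum_law:
  "(\<Sum>k\<le>Suc K. law_weight K k * f (law_point K k))
     = f 0 + (\<Sum>k=1..K. (1/8)^k * (f (sqrt (real k)) - f 0 + sqrt (real k) * (f (-1) - f 0)))"
proof -
  have "{..K} = insert 0 {1..K}" by auto
  then have "(\<Sum>k\<le>K. law_weight K k * f (law_point K k))
      = (1 - (\<Sum>k=1..K. (1/8)^k * (1 + sqrt (real k)))) * f 0 + (\<Sum>k=1..K. (1/8)^k * f (sqrt (real k)))"
    by (simp add: law_weight_def law_point_def)
  then have "(\<Sum>k\<le>Suc K. law_weight K k * f (law_point K k))
      = (1 - (\<Sum>k=1..K. (1/8)^k * (1 + sqrt (real k)))) * f 0 + (\<Sum>k=1..K. (1/8)^k * f (sqrt (real k)))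
        + (\<Sum>k=1..K. (1/8)^k * sqrt (real k)) * f (-1)"
    by (simp add: law_weight_def law_point_def)
  then show ?thesis
    by (simp add: algebra_simps sum.distrib sum_subtractf sum_distrib_left)
qed

lemma sqrt_le_self: "k \<ge> 1 \<Longrightarrow> sqrt (real k) \<le> real k"
  by (rule real_le_lsqrt) (simp_all add: power2_eq_square)

lemma law_weight_nonneg: "0 \<le> law_weight K k"
proof -
  have "(\<Sum>k=1..K. (1/8::real)^k * (1 + sqrt (real k))) \<le> (\<Sum>k=1..K. 2 * (1/4)^k)"
  proof (rule sum_mono)
    fix k assume "k \<in> {1..K}"
    then have k: "k \<ge> 1" by simp
    have "1 + sqrt (real k) \<le> 2 * real k" using sqrt_le_self[OF k] k by simp
    also have "\<dots> \<le> 2 * 2 ^ k"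
      using of_nat_less_two_power[of k] by (simp add: less_imp_le)
    finally have "(1/8::real)^k * (1 + sqrt (real k)) \<le> (1/8)^k * (2 * 2^k)"
      by (intro mult_left_mono) auto
    also have "\<dots> = 2 * (1/4)^k" by (simp add: power_divide power_mult_distrib[symmetric] field_simps)
    finally show "(1/8::real)^k * (1 + sqrt (real k)) \<le> 2 * (1/4)^k" .
  qed
  also have "\<dots> = 2 * ((1 - (1/4)^K) / 3)" by (simp only: sum_distrib_left[symmetric] sum_quarter_powers)
  also have "\<dots> \<le> 1"
  proof -
    have "2 * ((1 - q) / 3) \<le> 1" if "0 \<le> q" for q :: real using that by simp
    from this[of "(1/4)^K"] show ?thesis by (simp only: zero_le_power zero_le_divide_1_iff zero_le_numeral)
  qed
  finally show ?thesis by (auto simp: law_weight_def intro!: sum_nonneg)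
qed

lemma sum_law_weight: "(\<Sum>k\<le>Suc K. law_weight K k) = 1"
  using sum_law[of K "\<lambda>_. 1"] by simp

lemma law_moment_0: "law_moment K 0 = 1"
  using sum_law_weight by (simp add: law_moment_def)

lemma law_moment_1: "law_moment K 1 = 0"
  using sum_law[of K "\<lambda>x. x"] by (simp add: law_moment_def)

lemma law_moment_term:
  assumes "m \<ge> 2" "k \<ge> 1"
  shows "0 \<le> sqrt (real k) ^ m + sqrt (real k) * (-1) ^ m"
    and "k \<ge> 2 \<Longrightarrow> sqrt (real k) ^ m / 2 \<le> sqrt (real k) ^ m + sqrt (real k) * (-1) ^ m"
proof -
  have s1: "sqrt (real k) \<ge> 1" using assms by simp
  have "sqrt (real k) ^ 1 \<le> sqrt (real k) ^ m" using s1 assms by (intro power_increasing) auto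
  moreover have "sqrt (real k) * (-1) ^ m \<ge> - sqrt (real k)"
    using s1 by (cases "even m") auto
  ultimately show "0 \<le> sqrt (real k) ^ m + sqrt (real k) * (-1) ^ m" by simp
  assume k: "k \<ge> 2"
  show "sqrt (real k) ^ m / 2 \<le> sqrt (real k) ^ m + sqrt (real k) * (-1) ^ m"
  proof (cases "even m")
    case True then show ?thesis using s1 by simp
  next
    case False
    then have "m \<ge> 3" using assms by (cases "m = 2") auto
    then have "sqrt (real k) ^ 3 \<le> sqrt (real k) ^ m" using s1 by (intro power_increasing) auto
    moreover have "sqrt (real k) ^ 3 = real k * sqrt (real k)" by (simp add: power3_eq_cube)
    moreover have "2 * sqrt (real k) \<le> real k * sqrt (real k)" using k by (intro mult_right_mono) auto
    ultimately show ?thesis using False by simp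
  qed
qed

lemma law_moment_eq:
  "m \<ge> 1 \<Longrightarrow> law_moment K m = (\<Sum>k=1..K. (1/8)^k * (sqrt (real k) ^ m + sqrt (real k) * (-1) ^ m))"
  unfolding law_moment_def sum_law[of K "\<lambda>x. x ^ m"] by (simp add: zero_power)

lemma law_moment_nonneg: "0 \<le> law_moment K m"
proof -
  consider "m = 0" | "m = 1" | "m \<ge> 2" by linarith
  then show ?thesis
  proof cases
    case 3
    then show ?thesis
      by (subst law_moment_eq) (auto intro!: sum_nonneg mult_nonneg_nonneg law_moment_term(1))
  qed (simp_all add: law_moment_0 law_moment_1)
qed

text \<open>
  The single atom at \<open>sqrt m\<close> already contributes a moment of the size of a Gaussian moment,
  and the atom at \<open>-1\<close> cancels at most half of it.
\<close>

lemma law_moment_ge: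
  assumes "2 \<le> m" "m \<le> K"
  shows "(1/8)^m * sqrt (real m) ^ m / 2 \<le> law_moment K m"
proof -
  have "(1/8)^m * sqrt (real m) ^ m / 2 \<le> (1/8)^m * (sqrt (real m) ^ m + sqrt (real m) * (-1) ^ m)"
    using mult_left_mono[OF law_moment_term(2)[of m m], of "(1/8)^m"] assms by simp
  also have "\<dots> \<le> (\<Sum>k=1..K. (1/8)^k * (sqrt (real k) ^ m + sqrt (real k) * (-1) ^ m))"
    using assms by (intro member_le_sum mult_nonneg_nonneg law_moment_term) auto
  also have "\<dots> = law_moment K m" using assms by (subst law_moment_eq) auto
  finally show ?thesis .
qed

lemma exp_le_taylor: "exp t \<le> 1 + t + t\<^sup>2 * exp \<bar>t\<bar>" for t :: real
proof -
  obtain x where x: "\<bar>x\<bar> \<le> \<bar>t\<bar>" "exp t = (\<Sum>m<2. t ^ m / fact m) + exp x / fact 2 * t ^ 2"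
    using Maclaurin_exp_le[of t 2] by blast
  have "exp x / fact 2 \<le> exp x" by simp
  also have "exp x \<le> exp \<bar>t\<bar>" using x(1) by simp
  finally have "exp x / fact 2 * t\<^sup>2 \<le> exp \<bar>t\<bar> * t\<^sup>2" by (rule mult_right_mono) simp
  moreover have "(\<Sum>m<2. t ^ m / fact m) = 1 + t" by (simp add: numeral_2_eq_2)
  ultimately show ?thesis using x(2) by (simp only: mult.commute add_left_mono)
qed

lemma exp_quarter_le: "exp (real k / 4) \<le> 2 ^ k"
proof -
  have "exp (1/4::real) \<le> 2" using exp_bound[of "1/4::real"] by (simp add: power2_eq_square)
  then have "exp (1/4::real) ^ k \<le> 2 ^ k" by (intro power_mono) auto
  then show ?thesis by (simp add: exp_of_nat_mult[symmetric])
qed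

text \<open>
  The law is itself subgaussian. Since its mean is zero, only the second-order term of the exponential
  remains, and \<open>\<bar>s\<bar> * sqrt k \<le> s\<^sup>2 + k / 4\<close> separates the parameter from the atom.
\<close>

lemma law_mgf: "(\<Sum>k\<le>Suc K. law_weight K k * exp (s * law_point K k)) \<le> exp (3 * s\<^sup>2)"
proof -
  have "(\<Sum>k\<le>Suc K. law_weight K k * exp (s * law_point K k))
      = 1 + (\<Sum>k=1..K. (1/8)^k * (exp (s * sqrt (real k)) - 1 + sqrt (real k) * (exp (- s) - 1)))"
    using sum_law[of K "\<lambda>x. exp (s * x)"] by simp
  also have "(\<Sum>k=1..K. (1/8)^k * (exp (s * sqrt (real k)) - 1 + sqrt (real k) * (exp (- s) - 1)))
      \<le> (\<Sum>k=1..K. (2 * s\<^sup>2 * exp (s\<^sup>2)) * (1/2)^k)"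
  proof (rule sum_mono)
    fix k assume "k \<in> {1..K}"
    then have k: "k \<ge> 1" by simp
    define q where "q = sqrt (real k)"
    have q: "q \<ge> 1" "q\<^sup>2 = real k" "q \<le> real k" using k sqrt_le_self[OF k] by (simp_all add: q_def)
    have "exp (s * q) \<le> 1 + s * q + (s * q)\<^sup>2 * exp \<bar>s * q\<bar>" by (rule exp_le_taylor)
    moreover have "q * exp (- s) \<le> q * (1 + (- s) + (- s)\<^sup>2 * exp \<bar>- s\<bar>)"
      using q by (intro mult_left_mono exp_le_taylor) auto
    ultimately have "exp (s * q) - 1 + q * (exp (- s) - 1)
        \<le> s\<^sup>2 * (real k * exp (\<bar>s\<bar> * q)) + s\<^sup>2 * (q * exp \<bar>s\<bar>)"
      using q by (simp add: power_mult_distrib abs_mult algebra_simps)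
    also have "\<dots> \<le> s\<^sup>2 * (real k * exp (\<bar>s\<bar> * q)) + s\<^sup>2 * (real k * exp (\<bar>s\<bar> * q))"
      using q by (intro add_left_mono mult_left_mono mult_mono) (auto simp: mult_le_cancel_left1)
    also have "\<dots> = 2 * s\<^sup>2 * (real k * exp (\<bar>s\<bar> * q))" by simp
    also have "\<dots> \<le> 2 * s\<^sup>2 * (2 ^ k * (exp (s\<^sup>2) * 2 ^ k))"
    proof (intro mult_left_mono mult_mono)
      have "0 \<le> (\<bar>s\<bar> - q / 2)\<^sup>2" by simp
      then have "\<bar>s\<bar> * q \<le> s\<^sup>2 + real k / 4"
        using q(2) by (simp add: power2_diff power_divide)
      then have "exp (\<bar>s\<bar> * q) \<le> exp (s\<^sup>2) * exp (real k / 4)" by (simp add: exp_add[symmetric])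
      also have "\<dots> \<le> exp (s\<^sup>2) * 2 ^ k" by (intro mult_left_mono exp_quarter_le) auto
      finally show "exp (\<bar>s\<bar> * q) \<le> exp (s\<^sup>2) * 2 ^ k" .
      show "real k \<le> 2 ^ k" using of_nat_less_two_power[of k] by (simp add: less_imp_le)
    qed auto
    finally have "(1/8)^k * (exp (s * q) - 1 + q * (exp (- s) - 1))
        \<le> (1/8)^k * (2 * s\<^sup>2 * (2 ^ k * (exp (s\<^sup>2) * 2 ^ k)))"
      by (intro mult_left_mono) auto
    also have "\<dots> = (2 * s\<^sup>2 * exp (s\<^sup>2)) * ((1/8)^k * 2^k * 2^k)" by simp
    also have "(1/8::real)^k * 2^k * 2^k = (1/2)^k" by (simp flip: power_mult_distrib)
    finally show "(1/8)^k * (exp (s * sqrt (real k)) - 1 + sqrt (real k) * (exp (- s) - 1))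
        \<le> (2 * s\<^sup>2 * exp (s\<^sup>2)) * (1/2)^k" by (simp add: q_def)
  qed
  also have "\<dots> = (2 * s\<^sup>2 * exp (s\<^sup>2)) * (1 - (1/2)^K)"
    by (simp only: sum_distrib_left[symmetric] sum_half_powers)
  also have "\<dots> \<le> 2 * s\<^sup>2 * exp (s\<^sup>2)" by (simp add: mult_left_le)
  also have "1 + 2 * s\<^sup>2 * exp (s\<^sup>2) \<le> exp (s\<^sup>2) * (1 + 2 * s\<^sup>2)" by (simp add: algebra_simps)
  also have "\<dots> \<le> exp (s\<^sup>2) * exp (2 * s\<^sup>2)" by (intro mult_left_mono exp_ge_add_one_self) auto
  also have "\<dots> = exp (3 * s\<^sup>2)" by (simp add: exp_add[symmetric])
  finally show ?thesis by simp
qed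

section \<open>The operator norm on a finite grid\<close>

text \<open>
  The bilinear form of \<open>B\<close> on vectors indexed by \<open>{1..r}\<close>.
\<close>

definition bilinear :: "nat \<Rightarrow> (nat \<Rightarrow> nat \<Rightarrow> real) \<Rightarrow> (nat \<Rightarrow> real) \<Rightarrow> (nat \<Rightarrow> real) \<Rightarrow> real" where
  "bilinear r B x y = (\<Sum>i\<in>{1..r}. x i * mat_vec r B y i)"

lemma bilinear_le:
  "bilinear r B x y \<le> op_norm r B * (L2_set x {1..r} * L2_set y {1..r})"
proof -
  have "bilinear r B x y \<le> L2_set x {1..r} * L2_set (mat_vec r B y) {1..r}"
    unfolding bilinear_def by (rule sum_mult_le_L2_set)
  also have "\<dots> \<le> L2_set x {1..r} * (op_norm r B * L2_set y {1..r})"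
    by (intro mult_left_mono L2_set_mat_vec_le L2_set_nonneg)
  finally show ?thesis by (simp add: mult_ac)
qed

lemma L2_set_le_dual:
  assumes "finite A" and "\<And>x. L2_set x A \<le> 1 \<Longrightarrow> (\<Sum>i\<in>A. x i * v i) \<le> c" and "c \<ge> 0"
  shows "L2_set v A \<le> c"
proof (cases "L2_set v A = 0")
  case False
  define t where "t = L2_set v A"
  have t: "t > 0" using False L2_set_nonneg[of v A] unfolding t_def by linarith
  have "L2_set (\<lambda>i. (1/t) * v i) A = 1/t * t" unfolding t_def using t by (subst L2_set_scale) (auto simp: t_def)
  then have "L2_set (\<lambda>i. (1/t) * v i) A \<le> 1" using t by simp
  from assms(2)[OF this] have "(1/t) * (\<Sum>i\<in>A. (v i)\<^sup>2) \<le> c"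
    by (simp add: sum_distrib_left power2_eq_square mult_ac)
  moreover have "(\<Sum>i\<in>A. (v i)\<^sup>2) = t * t"
    unfolding t_def by (metis L2_set_sq power2_eq_square)
  ultimately show ?thesis using t by (simp add: t_def)
qed (use assms in simp)

text \<open>
  The net consists of the points of the lattice with mesh \<open>1 / (4 * sqrt r)\<close> that lie in the unit ball; they
  are represented by their integer coordinates. Points of the unit ball satisfy the bound on the
  \<open>l\<^sup>1\<close> norm by Cauchy--Schwarz; it is what the cardinality estimate uses.
\<close>

definition grid_point :: "nat \<Rightarrow> (nat \<Rightarrow> int) \<Rightarrow> nat \<Rightarrow> real" where
  "grid_point r z i = real_of_int (z i) / (4 * sqrt (real r))"

definition grid :: "nat \<Rightarrow> (nat \<Rightarrow> int) set" where
  "grid r = {z \<in> PiE {1..r} (\<lambda>_. {- 4 * int r..4 * int r}).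
     (\<Sum>i\<in>{1..r}. \<bar>z i\<bar>) \<le> 4 * int r \<and> L2_set (grid_point r z) {1..r} \<le> 1}"

lemma finite_grid: "finite (grid r)"
  unfolding grid_def by (rule finite_subset[of _ "PiE {1..r} (\<lambda>_. {- 4 * int r..4 * int r})"])
    (auto intro: finite_PiE)

lemma sum_half_abs_powers: "(\<Sum>k\<in>{- int m..int m}. (1/2::real) ^ nat \<bar>k\<bar>) \<le> 3"
proof -
  have "(\<Sum>k\<in>{- int m..int m}. (1/2::real) ^ nat \<bar>k\<bar>) = 3 - 2 * (1/2)^m"
  proof (induction m)
    case (Suc m)
    have "{- int (Suc m)..int (Suc m)} = insert (- int (Suc m)) (insert (int (Suc m)) {- int m..int m})"
      by auto
    moreover have "- int (Suc m) \<notin> insert (int (Suc m)) {- int m..int m}" "int (Suc m) \<notin> {- int m..int m}"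
      by auto
    moreover have "nat \<bar>- int (Suc m)\<bar> = Suc m" "nat \<bar>int (Suc m)\<bar> = Suc m" by auto
    ultimately have "(\<Sum>k\<in>{- int (Suc m)..int (Suc m)}. (1/2::real) ^ nat \<bar>k\<bar>)
        = (1/2) ^ Suc m + ((1/2) ^ Suc m + (\<Sum>k\<in>{- int m..int m}. (1/2::real) ^ nat \<bar>k\<bar>))"
      by (simp only: sum.insert finite_atLeastAtMost_int finite_insert simp_thms)
    then show ?case unfolding Suc by simp
  qed simp
  then show ?thesis by simp
qed

text \<open>
  Each point of the grid has weight at least \<open>16 ^ (- r)\<close> under the product weight with factors
  \<open>(1/2) ^ \<bar>z i\<bar>\<close>, whose total mass is at most \<open>3 ^ r\<close>.
\<close>

lemma card_grid: "real (card (grid r)) \<le> 48 ^ r"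
proof -
  let ?P = "PiE {1..r} (\<lambda>_. {- 4 * int r..4 * int r})"
  have fin: "finite ?P" by (intro finite_PiE) auto
  have "real (card (grid r)) = (\<Sum>z\<in>grid r. 1)" by simp
  also have "\<dots> \<le> (\<Sum>z\<in>grid r. 16 ^ r * (\<Prod>i\<in>{1..r}. (1/2::real) ^ nat \<bar>z i\<bar>))"
  proof (rule sum_mono)
    fix z assume "z \<in> grid r"
    then have "(\<Sum>i\<in>{1..r}. \<bar>z i\<bar>) \<le> 4 * int r" by (simp add: grid_def)
    moreover have "int (\<Sum>i\<in>{1..r}. nat \<bar>z i\<bar>) = (\<Sum>i\<in>{1..r}. \<bar>z i\<bar>)" by simp
    ultimately have "(\<Sum>i\<in>{1..r}. nat \<bar>z i\<bar>) \<le> 4 * r" by linarith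
    then have "(1/2::real) ^ (4 * r) \<le> (1/2) ^ (\<Sum>i\<in>{1..r}. nat \<bar>z i\<bar>)"
      by (intro power_decreasing) auto
    then have "16 ^ r * (1/2::real) ^ (4 * r) \<le> 16 ^ r * (\<Prod>i\<in>{1..r}. (1/2::real) ^ nat \<bar>z i\<bar>)"
      by (intro mult_left_mono) (simp_all only: power_sum zero_le_power zero_le_numeral)
    moreover have "16 ^ r * (1/2::real) ^ (4 * r) = 1"
      by (simp only: power_mult power_mult_distrib[symmetric]) (simp add: power_divide)
    ultimately show "1 \<le> 16 ^ r * (\<Prod>i\<in>{1..r}. (1/2::real) ^ nat \<bar>z i\<bar>)" by simp
  qed
  also have "\<dots> \<le> (\<Sum>z\<in>?P. 16 ^ r * (\<Prod>i\<in>{1..r}. (1/2::real) ^ nat \<bar>z i\<bar>))"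
    by (rule sum_mono2[OF fin]) (auto simp: grid_def intro!: mult_nonneg_nonneg prod_nonneg)
  also have "\<dots> = 16 ^ r * (\<Prod>i\<in>{1..r}. \<Sum>k\<in>{- 4 * int r..4 * int r}. (1/2::real) ^ nat \<bar>k\<bar>)"
    by (subst prod_sum_PiE) (auto simp: sum_distrib_left)
  also have "\<dots> \<le> 16 ^ r * (\<Prod>i\<in>{1..r}. 3)"
    using sum_half_abs_powers[of "4 * r"] by (intro mult_left_mono prod_mono) (auto intro!: sum_nonneg)
  also have "\<dots> = 48 ^ r" by (simp flip: power_mult_distrib)
  finally show ?thesis .
qed

lemma exists_grid_point_near:
  assumes x: "L2_set x {1..r} \<le> 1" and r: "r \<ge> 1"
  shows "\<exists>z\<in>grid r. L2_set (\<lambda>i. x i - grid_point r z i) {1..r} \<le> 1/4"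
proof -
  define t where "t = 4 * sqrt (real r)"
  have t: "t > 0" "t\<^sup>2 = 16 * real r" using r by (simp_all add: t_def power_mult_distrib)
  \<comment> \<open>Coordinates are rounded towards zero, so that the norm does not grow.\<close>
  define rd where "rd a = (if a \<ge> 0 then \<lfloor>a * t\<rfloor> else - \<lfloor>- a * t\<rfloor>)" for a :: real
  have rd: "\<bar>real_of_int (rd a)\<bar> \<le> t * \<bar>a\<bar>" "\<bar>t * a - real_of_int (rd a)\<bar> \<le> 1" for a
  proof -
    have "0 \<le> \<lfloor>a * t\<rfloor>" if "a \<ge> 0" using that t by simp
    moreover have "0 \<le> \<lfloor>- a * t\<rfloor>" if "a < 0" using that t by (simp add: mult_nonpos_nonneg)
    ultimately show "\<bar>real_of_int (rd a)\<bar> \<le> t * \<bar>a\<bar>"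
      using of_int_floor_le[of "a * t"] of_int_floor_le[of "- a * t"]
      by (cases "a \<ge> 0") (simp_all add: rd_def mult.commute)
    show "\<bar>t * a - real_of_int (rd a)\<bar> \<le> 1"
    proof (cases "a \<ge> 0")
      case True
      then have "rd a = \<lfloor>a * t\<rfloor>" by (simp add: rd_def)
      moreover have "t * a = a * t" by simp
      ultimately show ?thesis by linarith
    next
      case False
      then have "rd a = - \<lfloor>- a * t\<rfloor>" by (simp add: rd_def)
      moreover have "t * a = - (- a * t)" by simp
      ultimately show ?thesis by linarith
    qed
  qed
  define z where "z = restrict (\<lambda>i. rd (x i)) {1..r}"
  have z: "z i = rd (x i)" if "i \<in> {1..r}" for i using that by (simp add: z_def)
  have gp: "grid_point r z i = real_of_int (rd (x i)) / t" if "i \<in> {1..r}" for i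
    by (simp only: grid_point_def z[OF that] t_def)
  have "(\<Sum>i\<in>{1..r}. \<bar>x i\<bar> * 1) \<le> L2_set (\<lambda>i. \<bar>x i\<bar>) {1..r} * L2_set (\<lambda>i. 1) {1..r}"
    by (rule sum_mult_le_L2_set)
  also have "\<dots> \<le> 1 * sqrt (real r)"
    using x by (intro mult_mono) (simp_all add: L2_set_def)
  finally have l1: "(\<Sum>i\<in>{1..r}. \<bar>x i\<bar>) \<le> sqrt (real r)" by simp
  have "real_of_int (\<Sum>i\<in>{1..r}. \<bar>z i\<bar>) = (\<Sum>i\<in>{1..r}. \<bar>real_of_int (rd (x i))\<bar>)"
    unfolding of_int_sum by (intro sum.cong refl) (simp add: z)
  also have "\<dots> \<le> (\<Sum>i\<in>{1..r}. t * \<bar>x i\<bar>)" by (intro sum_mono rd)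
  also have "\<dots> = t * (\<Sum>i\<in>{1..r}. \<bar>x i\<bar>)" by (rule sum_distrib_left[symmetric])
  also have "\<dots> \<le> t * sqrt (real r)" using t l1 by (intro mult_left_mono) auto
  also have "\<dots> = real_of_int (4 * int r)" by (simp add: t_def)
  finally have sum_z: "(\<Sum>i\<in>{1..r}. \<bar>z i\<bar>) \<le> 4 * int r" by (simp only: of_int_le_iff)
  have zP: "z \<in> PiE {1..r} (\<lambda>_. {- 4 * int r..4 * int r})"
  proof (rule PiE_I)
    fix i assume i: "i \<in> {1..r}"
    have "\<bar>z i\<bar> \<le> (\<Sum>i\<in>{1..r}. \<bar>z i\<bar>)" using i by (intro member_le_sum) auto
    then show "z i \<in> {- 4 * int r..4 * int r}" using sum_z by auto
  qed (simp only: z_def restrict_def if_False)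
  have "(\<Sum>i\<in>{1..r}. (grid_point r z i)\<^sup>2) \<le> (\<Sum>i\<in>{1..r}. (x i)\<^sup>2)"
  proof (rule sum_mono)
    fix i assume i: "i \<in> {1..r}"
    have "\<bar>grid_point r z i\<bar> \<le> \<bar>x i\<bar>"
      using rd(1)[of "x i"] t by (simp add: gp[OF i] field_simps)
    then show "(grid_point r z i)\<^sup>2 \<le> (x i)\<^sup>2" by (simp only: abs_le_square_iff)
  qed
  then have "L2_set (grid_point r z) {1..r} \<le> 1"
    using x unfolding L2_set_def by (meson order_trans real_sqrt_le_mono)
  then have "z \<in> grid r" using zP sum_z by (simp add: grid_def)
  moreover have "L2_set (\<lambda>i. x i - grid_point r z i) {1..r} \<le> 1/4"
  proof -
    have "(\<Sum>i\<in>{1..r}. (x i - grid_point r z i)\<^sup>2) \<le> (\<Sum>i\<in>{1..r}. (1/t)\<^sup>2)"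
    proof (rule sum_mono)
      fix i assume i: "i \<in> {1..r}"
      have "x i - grid_point r z i = (t * x i - real_of_int (rd (x i))) / t"
        using t by (simp add: gp[OF i] field_simps)
      then have "\<bar>x i - grid_point r z i\<bar> \<le> \<bar>1/t\<bar>"
        using rd(2)[of "x i"] t by (simp add: divide_right_mono)
      then show "(x i - grid_point r z i)\<^sup>2 \<le> (1/t)\<^sup>2" by (simp only: abs_le_square_iff)
    qed
    also have "\<dots> = 1/16" using r t(2) by (simp add: power_divide)
    finally have "L2_set (\<lambda>i. x i - grid_point r z i) {1..r} \<le> sqrt (1/16)"
      unfolding L2_set_def by (rule real_sqrt_le_mono)
    also have "sqrt (1/16) = (1/4::real)" by (rule real_sqrt_unique) (simp_all add: power2_eq_square)
    finally show ?thesis .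
  qed
  ultimately show ?thesis by blast
qed

text \<open>
  Replacing both arguments of the bilinear form by nearby grid points costs at most half of the operator norm.
\<close>

lemma op_norm_le_grid:
  assumes r: "r \<ge> 1"
    and c: "\<And>z z'. z \<in> grid r \<Longrightarrow> z' \<in> grid r \<Longrightarrow> bilinear r B (grid_point r z) (grid_point r z') \<le> c"
    and "c \<ge> 0"
  shows "op_norm r B \<le> 2 * c"
proof -
  have "op_norm r B \<le> c + op_norm r B / 2"
  proof (rule op_norm_leI)
    fix y assume y: "L2_set y {1..r} \<le> 1"
    show "L2_set (mat_vec r B y) {1..r} \<le> c + op_norm r B / 2"
    proof (rule L2_set_le_dual)
      fix x assume x: "L2_set x {1..r} \<le> 1"
      obtain z where z: "z \<in> grid r" "L2_set (\<lambda>i. x i - grid_point r z i) {1..r} \<le> 1/4"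
        using exists_grid_point_near[OF x r] by blast
      obtain z' where z': "z' \<in> grid r" "L2_set (\<lambda>i. y i - grid_point r z' i) {1..r} \<le> 1/4"
        using exists_grid_point_near[OF y r] by blast
      let ?x = "grid_point r z" and ?y = "grid_point r z'"
      have mv: "mat_vec r B y i = mat_vec r B ?y i + mat_vec r B (\<lambda>i. y i - ?y i) i" for i
        by (simp add: mat_vec_def sum.distrib[symmetric] algebra_simps)
      have "(\<Sum>i\<in>{1..r}. x i * mat_vec r B y i)
          = bilinear r B ?x ?y + bilinear r B (\<lambda>i. x i - ?x i) y + bilinear r B ?x (\<lambda>i. y i - ?y i)"
        unfolding bilinear_def sum.distrib[symmetric]
        by (intro sum.cong refl) (subst mv, simp add: mv algebra_simps)
      moreover have "bilinear r B ?x ?y \<le> c" using c z z' by blast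
      moreover have "bilinear r B (\<lambda>i. x i - ?x i) y \<le> op_norm r B * (1/4 * 1)"
        by (rule order_trans[OF bilinear_le]) (intro mult_left_mono mult_mono z y op_norm_nonneg L2_set_nonneg, auto)
      moreover have "bilinear r B ?x (\<lambda>i. y i - ?y i) \<le> op_norm r B * (1 * (1/4))"
        using z(1) by (intro order_trans[OF bilinear_le] mult_left_mono mult_mono z' op_norm_nonneg L2_set_nonneg)
          (auto simp: grid_def)
      ultimately show "(\<Sum>i\<in>{1..r}. x i * mat_vec r B y i) \<le> c + op_norm r B / 2" by simp
    qed (use \<open>c \<ge> 0\<close> op_norm_nonneg[of r B] in auto)
  qed
  then show ?thesis by simp
qed

lemma op_norm_power_le_sum_grid:
  assumes "r \<ge> 1" "p \<ge> 1"
  shows "op_norm r B ^ (2 * p)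
     \<le> (\<Sum>z\<in>grid r. \<Sum>z'\<in>grid r. 4 ^ p * bilinear r B (grid_point r z) (grid_point r z') ^ (2 * p))"
proof -
  let ?b = "\<lambda>z z'. bilinear r B (grid_point r z) (grid_point r z')"
  define S where "S = (\<Sum>z\<in>grid r. \<Sum>z'\<in>grid r. ?b z z' ^ (2 * p))"
  have S0: "S \<ge> 0" unfolding S_def by (intro sum_nonneg) (simp add: power_mult)
  have "?b z z' \<le> root (2 * p) S" if "z \<in> grid r" "z' \<in> grid r" for z z'
  proof -
    have "?b z z' ^ (2 * p) \<le> (\<Sum>z'\<in>grid r. ?b z z' ^ (2 * p))"
      using that by (intro member_le_sum finite_grid) (simp_all add: power_mult)
    also have "\<dots> \<le> S"
      unfolding S_def using that
      by (intro member_le_sum[where f = "\<lambda>z. \<Sum>z'\<in>grid r. ?b z z' ^ (2 * p)"] finite_grid sum_nonneg)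
        (simp_all add: power_mult)
    finally have "\<bar>?b z z'\<bar> ^ (2 * p) \<le> S" by (simp add: power_even_abs)
    then have "root (2 * p) (\<bar>?b z z'\<bar> ^ (2 * p)) \<le> root (2 * p) S"
      using assms(2) by (intro real_root_le_mono) auto
    then have "\<bar>?b z z'\<bar> \<le> root (2 * p) S" using assms(2) by (simp add: real_root_power_cancel)
    then show ?thesis by simp
  qed
  from op_norm_le_grid[OF assms(1) this] have "op_norm r B \<le> 2 * root (2 * p) S"
    using real_root_ge_zero[OF S0] by blast
  then have "op_norm r B ^ (2 * p) \<le> (2 * root (2 * p) S) ^ (2 * p)"
    by (intro power_mono op_norm_nonneg)
  also have "\<dots> = 2 ^ (2 * p) * S" using S0 assms(2) by (simp add: power_mult_distrib)
  also have "\<dots> = 4 ^ p * S" by (simp add: power_mult)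
  finally show ?thesis by (simp add: S_def sum_distrib_left)
qed

section \<open>Moments of the comparison matrix\<close>

lemma power_div_fact_le_exp: "x ^ m / fact m \<le> exp x" if "0 \<le> x" for x :: real
proof -
  have s: "summable (\<lambda>n. inverse (fact n) * x ^ n)" by (rule summable_exp)
  have "(\<Sum>n\<in>{m}. inverse (fact n) * x ^ n) \<le> (\<Sum>n. inverse (fact n) * x ^ n)"
    by (rule sum_le_suminf[OF s]) (use that in auto)
  then show ?thesis by (simp add: exp_def scaleR_conv_of_real field_simps)
qed

lemma abs_power_le_exp: "\<bar>x\<bar> ^ m \<le> fact m * (exp x + exp (- x))" for x :: real
proof -
  have "\<bar>x\<bar> ^ m / fact m \<le> exp \<bar>x\<bar>" by (rule power_div_fact_le_exp) simp
  also have "\<dots> \<le> exp x + exp (- x)" by (cases "x \<ge> 0") simp_all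
  finally show ?thesis by (simp add: field_simps)
qed

text \<open>
  Grouping the terms with the same unordered index pair exhibits the bilinear form as a linear
  combination of the independent entries.
\<close>

lemma bilinear_sym_matrix:
  "bilinear r (sym_matrix y \<phi>) u v
     = (\<Sum>e\<in>upper_pairs r. (\<Sum>z | z \<in> {1..r} \<times> {1..r} \<and> (min (fst z) (snd z), max (fst z) (snd z)) = e. u (fst z) * v (snd z)) * y (\<phi> e))"
proof -
  let ?ed = "\<lambda>z :: nat \<times> nat. (min (fst z) (snd z), max (fst z) (snd z))"
  have "bilinear r (sym_matrix y \<phi>) u v
      = (\<Sum>z\<in>{1..r} \<times> {1..r}. (u (fst z) * v (snd z)) * y (\<phi> (?ed z)))"
    unfolding bilinear_def mat_vec_def sum_distrib_left sum.cartesian_product'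
    by (simp add: sym_matrix_def mult_ac)
  also have "\<dots> = (\<Sum>e\<in>upper_pairs r. \<Sum>z | z \<in> {1..r} \<times> {1..r} \<and> ?ed z = e. (u (fst z) * v (snd z)) * y (\<phi> (?ed z)))"
    by (rule sum.group[OF _ finite_upper_pairs, symmetric]) (auto simp: upper_pairs_def)
  also have "\<dots> = (\<Sum>e\<in>upper_pairs r. \<Sum>z | z \<in> {1..r} \<times> {1..r} \<and> ?ed z = e. (u (fst z) * v (snd z)) * y (\<phi> e))"
    by (intro sum.cong refl) auto
  finally show ?thesis by (simp only: sum_distrib_right)
qed

lemma sum_coeff_squares_le:
  "(\<Sum>e\<in>upper_pairs r. (\<Sum>z | z \<in> {1..r} \<times> {1..r} \<and> (min (fst z) (snd z), max (fst z) (snd z)) = e. u (fst z) * v (snd z))\<^sup>2)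
     \<le> 2 * (L2_set u {1..r})\<^sup>2 * (L2_set v {1..r})\<^sup>2"
proof -
  let ?ed = "\<lambda>z :: nat \<times> nat. (min (fst z) (snd z), max (fst z) (snd z))"
  let ?S = "\<lambda>e. {z. z \<in> {1..r} \<times> {1..r} \<and> ?ed z = e}"
  have card2: "card (?S e) \<le> 2" for e
  proof -
    have "?S e \<subseteq> {(fst e, snd e), (snd e, fst e)}" by (auto simp: min_def max_def)
    then have "card (?S e) \<le> card {(fst e, snd e), (snd e, fst e)}" by (intro card_mono) auto
    also have "\<dots> \<le> 2" by (simp add: card_insert_if)
    finally show ?thesis .
  qed
  have "(\<Sum>z\<in>?S e. u (fst z) * v (snd z))\<^sup>2 \<le> (\<Sum>z\<in>?S e. 2 * (u (fst z) * v (snd z))\<^sup>2)" for e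
  proof -
    have "(\<Sum>z\<in>?S e. u (fst z) * v (snd z))\<^sup>2
        = (\<Sum>z\<in>?S e. 1 * (u (fst z) * v (snd z)))\<^sup>2" by simp
    also have "\<dots> \<le> (\<Sum>z\<in>?S e. 1\<^sup>2) * (\<Sum>z\<in>?S e. (u (fst z) * v (snd z))\<^sup>2)"
      by (rule Cauchy_Schwarz_ineq_sum)
    also have "\<dots> \<le> 2 * (\<Sum>z\<in>?S e. (u (fst z) * v (snd z))\<^sup>2)"
      using card2[of e] by (intro mult_right_mono sum_nonneg) (simp_all only: power_one sum_constant, simp_all)
    finally show ?thesis by (simp only: sum_distrib_left)
  qed
  then have "(\<Sum>e\<in>upper_pairs r. (\<Sum>z\<in>?S e. u (fst z) * v (snd z))\<^sup>2)
      \<le> (\<Sum>e\<in>upper_pairs r. \<Sum>z\<in>?S e. 2 * (u (fst z) * v (snd z))\<^sup>2)"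
    by (intro sum_mono)
  also have "\<dots> = (\<Sum>z\<in>{1..r} \<times> {1..r}. 2 * (u (fst z) * v (snd z))\<^sup>2)"
    by (rule sum.group[OF _ finite_upper_pairs]) (auto simp: upper_pairs_def)
  also have "\<dots> = 2 * (L2_set u {1..r})\<^sup>2 * (L2_set v {1..r})\<^sup>2"
    unfolding L2_set_sq sum.cartesian_product'
    by (simp add: sum_product sum_distrib_left power_mult_distrib mult_ac)
  finally show ?thesis .
qed

text \<open>
  Expectation over the independent entries, on and above the diagonal, of an \<open>r \<times> r\<close> symmetric matrix.
\<close>

abbreviation law_expect :: "nat \<Rightarrow> nat \<Rightarrow> ((nat \<times> nat \<Rightarrow> nat) \<Rightarrow> real) \<Rightarrow> real" where
  "law_expect K r \<equiv> prod_expect (upper_pairs r) {..Suc K} (law_weight K)"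

lemma law_expect_exp_bilinear:
  assumes "L2_set u {1..r} \<le> 1" "L2_set v {1..r} \<le> 1"
  shows "law_expect K r (\<lambda>\<phi>. exp (s * bilinear r (sym_matrix (law_point K) \<phi>) u v)) \<le> exp (6 * s\<^sup>2)"
proof -
  define a where "a e = (\<Sum>z | z \<in> {1..r} \<times> {1..r} \<and> (min (fst z) (snd z), max (fst z) (snd z)) = e. u (fst z) * v (snd z))" for e
  have "(\<Sum>e\<in>upper_pairs r. (a e)\<^sup>2) \<le> 2 * (L2_set u {1..r})\<^sup>2 * (L2_set v {1..r})\<^sup>2"
    unfolding a_def by (rule sum_coeff_squares_le)
  also have "\<dots> \<le> 2 * 1\<^sup>2 * 1\<^sup>2"
    by (intro mult_mono power_mono assms L2_set_nonneg) auto
  finally have a2: "(\<Sum>e\<in>upper_pairs r. (a e)\<^sup>2) \<le> 2" by simp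
  have "law_expect K r (\<lambda>\<phi>. exp (s * bilinear r (sym_matrix (law_point K) \<phi>) u v))
      = law_expect K r (\<lambda>\<phi>. \<Prod>e\<in>upper_pairs r. exp ((s * a e) * law_point K (\<phi> e)))"
    unfolding bilinear_sym_matrix a_def[symmetric]
    by (simp add: sum_distrib_left exp_sum[OF finite_upper_pairs] mult.assoc)
  also have "\<dots> = (\<Prod>e\<in>upper_pairs r. \<Sum>k\<in>{..Suc K}. law_weight K k * exp ((s * a e) * law_point K k))"
    by (rule prod_expect_prod[OF finite_upper_pairs]) simp
  also have "\<dots> \<le> (\<Prod>e\<in>upper_pairs r. exp (3 * (s * a e)\<^sup>2))"
    by (intro prod_mono conjI law_mgf sum_nonneg mult_nonneg_nonneg law_weight_nonneg) simp
  also have "\<dots> = exp (3 * s\<^sup>2 * (\<Sum>e\<in>upper_pairs r. (a e)\<^sup>2))"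
    by (simp add: exp_sum[OF finite_upper_pairs, symmetric] power_mult_distrib sum_distrib_left mult_ac)
  also have "\<dots> \<le> exp (3 * s\<^sup>2 * 2)"
    using a2 by (intro exp_le_cancel_iff[THEN iffD2] mult_left_mono) auto
  finally show ?thesis by simp
qed

text \<open>
  The exponential moment is used at \<open>s = \<plusminus>sqrt p\<close>, for which both \<open>exp (6 * s\<^sup>2)\<close> and the quotient of
  \<open>fact (2 * p)\<close> by \<open>s ^ (2 * p)\<close> are at most a power \<open>p\<close> of a multiple of \<open>p\<close>.
\<close>

lemma law_expect_bilinear_power:
  assumes "L2_set u {1..r} \<le> 1" "L2_set v {1..r} \<le> 1" and p: "p \<ge> 1"
  shows "law_expect K r (\<lambda>\<phi>. bilinear r (sym_matrix (law_point K) \<phi>) u v ^ (2 * p))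
     \<le> 2 * (4 * exp 6 * real p) ^ p"
proof -
  let ?b = "\<lambda>\<phi>. bilinear r (sym_matrix (law_point K) \<phi>) u v"
  let ?s = "sqrt (real p)"
  have "real p ^ p * ?b \<phi> ^ (2 * p) \<le> fact (2 * p) * (\<Sum>s\<in>{?s, - ?s}. exp (s * ?b \<phi>))" for \<phi>
  proof -
    have "real p ^ p * ?b \<phi> ^ (2 * p) = \<bar>?s * ?b \<phi>\<bar> ^ (2 * p)"
      by (simp add: power_mult power_mult_distrib)
    also have "\<dots> \<le> fact (2 * p) * (exp (?s * ?b \<phi>) + exp (- (?s * ?b \<phi>)))"
      by (rule abs_power_le_exp)
    finally show ?thesis using p by simp
  qed
  then have "law_expect K r (\<lambda>\<phi>. real p ^ p * ?b \<phi> ^ (2 * p))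
      \<le> law_expect K r (\<lambda>\<phi>. fact (2 * p) * (\<Sum>s\<in>{?s, - ?s}. exp (s * ?b \<phi>)))"
    by (intro prod_expect_mono law_weight_nonneg)
  also have "\<dots> = fact (2 * p) * (\<Sum>s\<in>{?s, - ?s}. law_expect K r (\<lambda>\<phi>. exp (s * ?b \<phi>)))"
    by (simp only: prod_expect_cmult prod_expect_sum)
  also have "\<dots> \<le> fact (2 * p) * (\<Sum>s\<in>{?s, - ?s}. exp (6 * s\<^sup>2))"
    by (intro mult_left_mono sum_mono law_expect_exp_bilinear assms) simp
  also have "\<dots> = fact (2 * p) * (2 * exp (6 * real p))" using p by simp
  also have "\<dots> \<le> real (2 * p) ^ (2 * p) * (2 * exp (6 * real p))"
  proof (rule mult_right_mono)
    show "fact (2 * p) \<le> real (2 * p) ^ (2 * p)"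
      using fact_le_power[of "2 * p", where 'a = real] by simp
  qed simp
  also have "\<dots> = real p ^ p * (2 * (4 * exp 6 * real p) ^ p)"
  proof -
    have "exp (6 * real p) = exp 6 ^ p" by (metis exp_of_nat_mult mult.commute)
    moreover have "real (2 * p) ^ (2 * p) = 4 ^ p * real p ^ p * real p ^ p"
      by (simp add: power_mult power_mult_distrib power2_eq_square)
    moreover have "(4 * exp 6 * real p) ^ p = 4 ^ p * exp 6 ^ p * real p ^ p"
      by (simp only: power_mult_distrib)
    ultimately show ?thesis by (simp only: mult_ac)
  qed
  finally have "real p ^ p * law_expect K r (\<lambda>\<phi>. ?b \<phi> ^ (2 * p)) \<le> real p ^ p * (2 * (4 * exp 6 * real p) ^ p)"
    by (simp only: prod_expect_cmult)
  then show ?thesis using p by (simp only: mult_le_cancel_left_pos zero_less_power of_nat_0_less_iff less_le_trans[OF zero_less_one])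
qed

text \<open>
  The maximum over the grid is bounded by the sum. The number of pairs of grid points is exponential in \<open>r\<close>, which is harmless
  as soon as \<open>p\<close> is at least of the order of \<open>r\<close>.
\<close>

lemma law_expect_trace_pow:
  assumes r: "r \<ge> 1" and p: "p \<ge> 1"
  shows "law_expect K r (\<lambda>\<phi>. trace_pow r (sym_matrix (law_point K) \<phi>) (2 * p))
     \<le> real r * 48 ^ (2 * r) * (2 * (16 * exp 6 * real p) ^ p)"
proof -
  let ?Y = "sym_matrix (law_point K)"
  let ?b = "\<lambda>\<phi> z z'. bilinear r (?Y \<phi>) (grid_point r z) (grid_point r z')"
  have "trace_pow r (?Y \<phi>) (2 * p) \<le> real r * (\<Sum>z\<in>grid r. \<Sum>z'\<in>grid r. 4 ^ p * ?b \<phi> z z' ^ (2 * p))" for \<phi>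
  proof -
    have "trace_pow r (?Y \<phi>) (2 * p) \<le> real r * op_norm r (?Y \<phi>) ^ (2 * p)"
      by (rule trace_pow_le_op_norm) (simp add: sym_matrix_def min.commute max.commute)
    also have "\<dots> \<le> real r * (\<Sum>z\<in>grid r. \<Sum>z'\<in>grid r. 4 ^ p * ?b \<phi> z z' ^ (2 * p))"
      by (intro mult_left_mono op_norm_power_le_sum_grid r p) simp
    finally show ?thesis .
  qed
  then have "law_expect K r (\<lambda>\<phi>. trace_pow r (?Y \<phi>) (2 * p))
      \<le> law_expect K r (\<lambda>\<phi>. real r * (\<Sum>z\<in>grid r. \<Sum>z'\<in>grid r. 4 ^ p * ?b \<phi> z z' ^ (2 * p)))"
    by (intro prod_expect_mono law_weight_nonneg)
  also have "\<dots> = real r * (\<Sum>z\<in>grid r. \<Sum>z'\<in>grid r. 4 ^ p * law_expect K r (\<lambda>\<phi>. ?b \<phi> z z' ^ (2 * p)))"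
    by (simp only: prod_expect_cmult prod_expect_sum)
  also have "\<dots> \<le> real r * (\<Sum>z\<in>grid r. \<Sum>z'\<in>grid r. 4 ^ p * (2 * (4 * exp 6 * real p) ^ p))"
    by (intro mult_left_mono sum_mono law_expect_bilinear_power p) (auto simp: grid_def)
  also have "\<dots> = real r * (real (card (grid r)) * (real (card (grid r)) * (4 ^ p * (2 * (4 * exp 6 * real p) ^ p))))"
    by (simp only: sum_constant)
  also have "\<dots> \<le> real r * (48 ^ r * (48 ^ r * (4 ^ p * (2 * (4 * exp 6 * real p) ^ p))))"
    by (intro mult_left_mono mult_mono card_grid) auto
  also have "\<dots> = real r * 48 ^ (2 * r) * (2 * (4 ^ p * (4 * exp 6 * real p) ^ p))"
  proof -
    have "(48::real) ^ (2 * r) = 48 ^ r * 48 ^ r" by (simp only: mult_2 power_add)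
    then show ?thesis by (simp only: mult_ac)
  qed
  also have "4 ^ p * (4 * exp 6 * real p) ^ p = (4 * (4 * exp 6 * real p)) ^ p"
    by (rule power_mult_distrib[symmetric])
  also have "4 * (4 * exp 6 * real p) = 16 * exp 6 * real p" by simp
  finally show ?thesis .
qed

section \<open>Moments of subgaussian variables\<close>

lemma subgaussian_integrable_power:
  assumes "subgaussian M v X"
  shows "integrable M (\<lambda>\<omega>. \<bar>X \<omega>\<bar> ^ m)" and "integrable M (\<lambda>\<omega>. X \<omega> ^ m)"
proof -
  have X [measurable]: "X \<in> borel_measurable M"
    using assms by (auto simp: subgaussian_def)
  have "integrable M (\<lambda>\<omega>. exp (s * X \<omega>))" for s
    using assms by (simp add: subgaussian_def)
  from this[of 1] this[of "-1"]
  have int: "integrable M (\<lambda>\<omega>. fact m * (exp (X \<omega>) + exp (- X \<omega>)))" by simp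
  show "integrable M (\<lambda>\<omega>. \<bar>X \<omega>\<bar> ^ m)"
    by (rule Bochner_Integration.integrable_bound[OF int])
      (auto intro!: AE_I2 order_trans[OF abs_power_le_exp] simp: power_abs)
  then show "integrable M (\<lambda>\<omega>. X \<omega> ^ m)"
    by (rule Bochner_Integration.integrable_bound) (auto simp: power_abs)
qed

text \<open>
  Obtained from the exponential moments at \<open>s = sqrt m / \<kappa>\<close>.
\<close>

lemma subgaussian_abs_moment:
  assumes sub: "subgaussian M (\<kappa>\<^sup>2) X" and \<kappa>: "\<kappa> > 0" and m: "m \<ge> 1"
  shows "(\<integral>\<omega>. \<bar>X \<omega>\<bar> ^ m \<partial>M) \<le> 2 * (exp 1 * \<kappa>) ^ m * sqrt (real m) ^ m"
proof -
  define s where "s = sqrt (real m) / \<kappa>"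
  have s: "s > 0" "\<kappa>\<^sup>2 * s\<^sup>2 / 2 = real m / 2"
    using \<kappa> m by (simp_all add: s_def power_divide)
  have ex: "integrable M (\<lambda>\<omega>. exp (t * X \<omega>))" "(\<integral>\<omega>. exp (t * X \<omega>) \<partial>M) \<le> exp (\<kappa>\<^sup>2 * t\<^sup>2 / 2)" for t
    using sub by (simp_all add: subgaussian_def)
  have "s ^ m * (\<integral>\<omega>. \<bar>X \<omega>\<bar> ^ m \<partial>M) = (\<integral>\<omega>. \<bar>s * X \<omega>\<bar> ^ m \<partial>M)"
    using s by (simp add: abs_mult power_mult_distrib)
  also have "\<dots> \<le> (\<integral>\<omega>. fact m * (exp (s * X \<omega>) + exp ((- s) * X \<omega>)) \<partial>M)"
  proof (rule integral_mono)
    show "integrable M (\<lambda>\<omega>. \<bar>s * X \<omega>\<bar> ^ m)"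
      using subgaussian_integrable_power(1)[OF sub, of m] by (simp add: abs_mult power_mult_distrib)
    show "integrable M (\<lambda>\<omega>. fact m * (exp (s * X \<omega>) + exp ((- s) * X \<omega>)))"
      using ex(1) by (intro integrable_mult_right Bochner_Integration.integrable_add)
    show "\<bar>s * X \<omega>\<bar> ^ m \<le> fact m * (exp (s * X \<omega>) + exp ((- s) * X \<omega>))" for \<omega>
      using abs_power_le_exp[of "s * X \<omega>" m] by simp
  qed
  also have "\<dots> = fact m * ((\<integral>\<omega>. exp (s * X \<omega>) \<partial>M) + (\<integral>\<omega>. exp ((- s) * X \<omega>) \<partial>M))"
    using ex(1)[of s] ex(1)[of "- s"] by simp
  also have "\<dots> \<le> fact m * (exp (real m / 2) + exp (real m / 2))"
    using ex(2)[of s] ex(2)[of "- s"] s(2) by (intro mult_left_mono add_mono) simp_all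
  also have "\<dots> \<le> real m ^ m * (exp (real m) + exp (real m))"
    using fact_le_power[of m, where 'a = real] by (intro mult_mono add_mono) simp_all
  also have "\<dots> = s ^ m * (2 * (exp 1 * \<kappa>) ^ m * sqrt (real m) ^ m)"
  proof -
    have "s ^ m * \<kappa> ^ m = sqrt (real m) ^ m" using \<kappa> by (simp add: s_def flip: power_mult_distrib)
    moreover have "real m ^ m = sqrt (real m) ^ m * sqrt (real m) ^ m" by (simp flip: power_mult_distrib)
    moreover have "exp (real m) = exp 1 ^ m" by (simp flip: exp_of_nat_mult)
    ultimately show ?thesis by (simp add: power_mult_distrib mult_ac)
  qed
  finally show ?thesis using s(1) by (simp only: mult_le_cancel_left_pos zero_less_power)
qed

text \<open>
  The comparison of moments is trivial in order \<open>0\<close>, and in order \<open>1\<close> both sides vanish. From order \<open>2\<close> on,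
  the factor \<open>16 * exp 1\<close> absorbs \<open>8 ^ m\<close> and the numerical constants.
\<close>

lemma subgaussian_moment_le_law_moment:
  assumes "prob_space M" and sub: "subgaussian M (\<kappa>\<^sup>2) X" and \<kappa>: "\<kappa> > 0" and m: "m \<le> K"
  shows "\<bar>\<integral>\<omega>. X \<omega> ^ m \<partial>M\<bar> \<le> (16 * exp 1 * \<kappa>) ^ m * law_moment K m"
proof -
  interpret prob_space M by fact
  consider "m = 0" | "m = 1" | "m \<ge> 2" by linarith
  then show ?thesis
  proof cases
    case 1 then show ?thesis by (simp add: law_moment_0 prob_space)
  next
    case 2 then show ?thesis using sub by (simp add: law_moment_1 subgaussian_def)
  next
    case 3
    have "\<bar>\<integral>\<omega>. X \<omega> ^ m \<partial>M\<bar> \<le> (\<integral>\<omega>. \<bar>X \<omega>\<bar> ^ m \<partial>M)"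
      unfolding power_abs[symmetric] by (rule integral_abs_bound)
    also have "\<dots> \<le> 2 * (exp 1 * \<kappa>) ^ m * sqrt (real m) ^ m"
      using 3 by (intro subgaussian_abs_moment sub \<kappa>) simp
    also have "\<dots> \<le> 2 ^ m / 2 * (exp 1 * \<kappa>) ^ m * sqrt (real m) ^ m"
    proof (intro mult_right_mono)
      have "(2::real) ^ 2 \<le> 2 ^ m" using 3 by (intro power_increasing) auto
      then show "2 \<le> (2::real) ^ m / 2" by simp
    qed (use \<kappa> in auto)
    also have "\<dots> = (16 * exp 1 * \<kappa>) ^ m * ((1/8) ^ m * sqrt (real m) ^ m / 2)"
    proof -
      have "(16::real) ^ m * (1/8) ^ m = 2 ^ m" unfolding power_mult_distrib[symmetric] by simp
      then show ?thesis by (simp only: power_mult_distrib mult_ac times_divide_eq_right)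
    qed
    also have "\<dots> \<le> (16 * exp 1 * \<kappa>) ^ m * law_moment K m"
      using 3 m \<kappa> by (intro mult_left_mono law_moment_ge) auto
    finally show ?thesis .
  qed
qed

section \<open>Moments of the sparse matrix\<close>

text \<open>
  The vertices adjacent to \<open>v\<close>.
\<close>

definition neighbours :: "nat \<Rightarrow> nat set set \<Rightarrow> nat \<Rightarrow> nat set" where
  "neighbours N E v = {u \<in> {1..N}. {v, u} \<in> E}"

lemma simple_graph_finite: "simple_graph N E \<Longrightarrow> finite E"
  unfolding simple_graph_def by (rule finite_subset[of _ "Pow {1..N}"]) auto

lemma card_neighbours_le:
  assumes "simple_graph N E" "v \<in> {1..N}"
  shows "finite (neighbours N E v) \<and> card (neighbours N E v) \<le> max_degree N E"
proof
  show "finite (neighbours N E v)" by (simp add: neighbours_def)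
  have "card (neighbours N E v) = card ((\<lambda>u. {v, u}) ` neighbours N E v)"
    by (rule card_image[symmetric]) (auto simp: inj_on_def doubleton_eq_iff)
  also have "\<dots> \<le> card {e \<in> E. v \<in> e}"
    using simple_graph_finite[OF assms(1)] by (intro card_mono) (auto simp: neighbours_def)
  also have "\<dots> \<le> max_degree N E"
    unfolding max_degree_def degree_def[symmetric] using assms(2) by (intro Max_ge) auto
  finally show "card (neighbours N E v) \<le> max_degree N E" .
qed

lemma avg_degree_le_max_degree:
  assumes E: "simple_graph N E" and N: "N \<ge> 1"
  shows "avg_degree N E \<le> real (max_degree N E)"
proof -
  have finE: "finite E" using simple_graph_finite[OF E] .
  have "(\<Sum>v\<in>{1..N}. degree E v) = (\<Sum>v\<in>{1..N}. \<Sum>e | e \<in> E \<and> v \<in> e. 1)"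
    by (simp add: degree_def)
  also have "\<dots> = (\<Sum>e\<in>E. \<Sum>v | v \<in> {1..N} \<and> v \<in> e. 1)"
    by (rule sum.swap_restrict) (auto simp: finE)
  also have "\<dots> = (\<Sum>e\<in>E. 2)"
  proof (intro sum.cong refl)
    fix e assume "e \<in> E"
    then have "{v. v \<in> {1..N} \<and> v \<in> e} = e" "card e = 2" using E unfolding simple_graph_def by blast+
    then show "(\<Sum>v | v \<in> {1..N} \<and> v \<in> e. 1) = (2::nat)" by simp
  qed
  finally have "2 * card E = (\<Sum>v\<in>{1..N}. degree E v)" by simp
  also have "\<dots> \<le> (\<Sum>v\<in>{1..N}. max_degree N E)"
    unfolding max_degree_def by (intro sum_mono Max_ge) auto
  finally have "2 * card E \<le> N * max_degree N E" by simp
  then have "2 * real (card E) \<le> real N * real (max_degree N E)"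
    by (metis of_nat_le_iff of_nat_mult of_nat_numeral)
  then show ?thesis using N by (simp add: avg_degree_def field_simps)
qed

text \<open>
  The expectation factorises over the distinct edges of the walk. These lie strictly above the diagonal
  because a simple graph has no loops.
\<close>

lemma expectation_walk_product:
  assumes M: "prob_space M" and sub: "subgaussian_matrix M N (\<kappa>\<^sup>2) G" and \<kappa>: "\<kappa> > 0"
    and E: "simple_graph N E"
    and w: "walk_list (neighbours N E) N w" "length w = Suc n" and n: "n \<le> K"
  defines "X \<equiv> \<lambda>\<omega>. \<Prod>k<n. hadamard (adjacency E) (G \<omega>) (w ! k) (w ! Suc k)"
  shows "integrable M X"
    and "\<bar>\<integral>\<omega>. X \<omega> \<partial>M\<bar> \<le> (16 * exp 1 * \<kappa>) ^ n * (\<Prod>e\<in>edge_set w. law_moment K (edge_mult w e))"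
proof -
  interpret prob_space M by (rule M)
  let ?P = "{(i, j). i \<in> {1..N} \<and> j \<in> {1..N} \<and> i < j}"
  define H where "H e \<omega> = (case e of (i, j) \<Rightarrow> G \<omega> i j)" for e \<omega>
  have len: "length w - 1 = n" using w by (simp add: One_nat_def)
  have step: "{w ! k, w ! Suc k} \<in> E" "w ! k \<in> {1..N}" "w ! Suc k \<in> {1..N}" "w ! k \<noteq> w ! Suc k" if "k < n" for k
  proof -
    have nb: "w ! Suc k \<in> neighbours N E (w ! k)" using w that by (simp add: walk_list_def)
    then show "{w ! k, w ! Suc k} \<in> E" "w ! Suc k \<in> {1..N}" by (simp_all add: neighbours_def)
    have "w ! k \<in> set w" using w that by simp
    then show "w ! k \<in> {1..N}" using w unfolding walk_list_def by blast
    have "card {w ! k, w ! Suc k} = 2" using nb E unfolding neighbours_def simple_graph_def by blast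
    then show "w ! k \<noteq> w ! Suc k" by auto
  qed
  have sub_P: "edge_set w \<subseteq> ?P"
  proof
    fix e assume "e \<in> edge_set w"
    then obtain k where k: "k < n" "e = edge w k" by (auto simp: edge_set_def len)
    then show "e \<in> ?P" using step[OF k(1)] by (auto simp: edge_def min_def max_def)
  qed
  have X_eq: "X \<omega> = (\<Prod>e\<in>edge_set w. H e \<omega> ^ edge_mult w e)" if \<omega>: "\<omega> \<in> space M" for \<omega>
  proof -
    have "X \<omega> = (\<Prod>k<n. H (edge w k) \<omega>)"
      unfolding X_def
    proof (intro prod.cong refl)
      fix k assume "k \<in> {..<n}"
      then have k: "k < n" by simp
      have "G \<omega> (w ! k) (w ! Suc k) = G \<omega> (w ! Suc k) (w ! k)"
        using sub \<omega> step[OF k] unfolding subgaussian_matrix_def by blast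
      then show "hadamard (adjacency E) (G \<omega>) (w ! k) (w ! Suc k) = H (edge w k) \<omega>"
        using step(1)[OF k] by (simp add: hadamard_def adjacency_def H_def edge_def min_def max_def)
    qed
    then show ?thesis using prod_steps_eq_prod_edges[of "\<lambda>e. H e \<omega>" w] len by simp
  qed
  have subg: "subgaussian M (\<kappa>\<^sup>2) (H e)" if "e \<in> edge_set w" for e
  proof -
    obtain i j where ij: "e = (i, j)" "i \<in> {1..N}" "j \<in> {1..N}" "i < j" using subsetD[OF sub_P \<open>e \<in> edge_set w\<close>] by auto
    then have "subgaussian M (\<kappa>\<^sup>2) (\<lambda>\<omega>. G \<omega> i j)" using sub unfolding subgaussian_matrix_def by blast
    then show ?thesis by (simp add: H_def[abs_def] ij)
  qed
  have "indep_vars (\<lambda>_. borel) (\<lambda>(i, j) \<omega>. G \<omega> i j) ?P"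
    using sub unfolding subgaussian_matrix_def by blast
  moreover have "(\<lambda>(i, j) \<omega>. G \<omega> i j) = H" by (auto simp: H_def fun_eq_iff)
  ultimately have "indep_vars (\<lambda>_. borel) H (edge_set w)"
    using indep_vars_subset[OF _ sub_P] by simp
  then have indep: "indep_vars (\<lambda>_. borel) (\<lambda>e \<omega>. H e \<omega> ^ edge_mult w e) (edge_set w)"
    by (rule indep_vars_compose2) simp
  have int: "integrable M (\<lambda>\<omega>. H e \<omega> ^ edge_mult w e)" if "e \<in> edge_set w" for e
    using subgaussian_integrable_power(2)[OF subg[OF that]] .
  have "integrable M (\<lambda>\<omega>. \<Prod>e\<in>edge_set w. H e \<omega> ^ edge_mult w e)"
    by (rule indep_vars_integrable[OF finite_edge_set indep int])
  then show "integrable M X"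
    by (rule Bochner_Integration.integrable_cong[THEN iffD1, rotated 2]) (simp_all add: X_eq)
  have mult_le: "edge_mult w e \<le> K" for e
  proof -
    have "edge_mult w e \<le> card {..<n}" unfolding edge_mult_def len by (rule card_mono) auto
    then show ?thesis using n by simp
  qed
  have "(\<integral>\<omega>. X \<omega> \<partial>M) = (\<integral>\<omega>. (\<Prod>e\<in>edge_set w. H e \<omega> ^ edge_mult w e) \<partial>M)"
    by (rule Bochner_Integration.integral_cong) (simp_all add: X_eq)
  also have "\<dots> = (\<Prod>e\<in>edge_set w. \<integral>\<omega>. H e \<omega> ^ edge_mult w e \<partial>M)"
    by (rule indep_vars_lebesgue_integral[OF finite_edge_set indep int])
  finally have "\<bar>\<integral>\<omega>. X \<omega> \<partial>M\<bar> = (\<Prod>e\<in>edge_set w. \<bar>\<integral>\<omega>. H e \<omega> ^ edge_mult w e \<partial>M\<bar>)"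
    by (simp only: abs_prod)
  also have "\<dots> \<le> (\<Prod>e\<in>edge_set w. (16 * exp 1 * \<kappa>) ^ edge_mult w e * law_moment K (edge_mult w e))"
    by (intro prod_mono conjI abs_ge_zero subgaussian_moment_le_law_moment M subg \<kappa> mult_le)
  also have "\<dots> = (16 * exp 1 * \<kappa>) ^ n * (\<Prod>e\<in>edge_set w. law_moment K (edge_mult w e))"
    by (simp only: prod.distrib power_sum[symmetric] sum_edge_mult len)
  finally show "\<bar>\<integral>\<omega>. X \<omega> \<partial>M\<bar> \<le> (16 * exp 1 * \<kappa>) ^ n * (\<Prod>e\<in>edge_set w. law_moment K (edge_mult w e))" .
qed

lemma expectation_trace_pow_le:
  assumes M: "prob_space M" and sub: "subgaussian_matrix M N (\<kappa>\<^sup>2) G" and \<kappa>: "\<kappa> > 0"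
    and E: "simple_graph N E" and n: "n \<le> K"
  defines "T \<equiv> \<lambda>\<omega>. trace_pow N (hadamard (adjacency E) (G \<omega>)) n"
  shows "integrable M T"
    and "(\<integral>\<omega>. T \<omega> \<partial>M) \<le> (16 * exp 1 * \<kappa>) ^ n *
           (\<Sum>w | walk_list (neighbours N E) N w \<and> length w = Suc n. walk_weight (law_moment K) w)"
proof -
  interpret prob_space M by (rule M)
  let ?b = "16 * exp 1 * \<kappa>"
  let ?W = "{w. walk_list (neighbours N E) N w \<and> length w = Suc n}"
  define X where "X w \<omega> = (\<Prod>k<n. hadamard (adjacency E) (G \<omega>) (w ! k) (w ! Suc k))" for w \<omega>
  define Z where "Z w \<omega> = (if w ! 0 = w ! n then X w \<omega> else 0)" for w \<omega>
  \<comment> \<open>A list with a step that is not an edge of the graph contributes nothing.\<close>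
  have Z0: "Z w \<omega> = 0" if w: "set w \<subseteq> {1..N}" "length w = Suc n" "w \<notin> ?W" for w \<omega>
  proof -
    obtain k where k: "Suc k < length w" "w ! Suc k \<notin> neighbours N E (w ! k)"
      using w by (auto simp: walk_list_def)
    have "w ! Suc k \<in> {1..N}" using w(1) nth_mem[OF k(1)] by blast
    then have "{w ! k, w ! Suc k} \<notin> E" using k(2) by (simp add: neighbours_def)
    then have "hadamard (adjacency E) (G \<omega>) (w ! k) (w ! Suc k) = 0"
      by (simp add: hadamard_def adjacency_def)
    moreover have "k \<in> {..<n}" using k w by simp
    ultimately have "X w \<omega> = 0" unfolding X_def by (intro prod_zero) auto
    then show ?thesis by (simp add: Z_def)
  qed
  have T_eq: "T \<omega> = (\<Sum>w\<in>?W. Z w \<omega>)" for \<omega>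
  proof -
    have "T \<omega> = (\<Sum>w | set w \<subseteq> {1..N} \<and> length w = Suc n. Z w \<omega>)"
      unfolding T_def trace_pow_eq_sum_walks Z_def X_def ..
    also have "\<dots> = (\<Sum>w\<in>?W. Z w \<omega>)"
    proof (rule sum.mono_neutral_right)
      show "finite {w. set w \<subseteq> {1..N} \<and> length w = Suc n}" by (rule finite_lists_length_eq) simp
      show "?W \<subseteq> {w. set w \<subseteq> {1..N} \<and> length w = Suc n}" by (auto simp: walk_list_def)
    qed (use Z0 in blast)
    finally show ?thesis .
  qed
  have Z: "integrable M (Z w)" "(\<integral>\<omega>. Z w \<omega> \<partial>M) \<le> ?b ^ n * walk_weight (law_moment K) w" if "w \<in> ?W" for w
  proof -
    have w: "walk_list (neighbours N E) N w" "length w = Suc n" using that by auto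
    note * = expectation_walk_product[OF M sub \<kappa> E w n, folded X_def]
    have len: "length w - 1 = n" using w by (simp add: One_nat_def)
    show "integrable M (Z w)" using *(1) by (cases "w ! 0 = w ! n") (simp_all add: Z_def[abs_def])
    show "(\<integral>\<omega>. Z w \<omega> \<partial>M) \<le> ?b ^ n * walk_weight (law_moment K) w"
    proof (cases "w ! 0 = w ! n")
      case True
      then have "(\<integral>\<omega>. Z w \<omega> \<partial>M) = (\<integral>\<omega>. X w \<omega> \<partial>M)" by (simp add: Z_def)
      also have "\<dots> \<le> ?b ^ n * (\<Prod>e\<in>edge_set w. law_moment K (edge_mult w e))" using *(2) by (rule abs_le_D1)
      finally show ?thesis using True by (simp add: walk_weight_def len)
    qed (simp add: Z_def walk_weight_def len)
  qed
  show "integrable M T"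
    unfolding T_eq[abs_def] by (rule Bochner_Integration.integrable_sum) (rule Z(1))
  have "(\<integral>\<omega>. T \<omega> \<partial>M) = (\<Sum>w\<in>?W. \<integral>\<omega>. Z w \<omega> \<partial>M)"
    unfolding T_eq by (rule Bochner_Integration.integral_sum) (rule Z(1))
  also have "\<dots> \<le> (\<Sum>w\<in>?W. ?b ^ n * walk_weight (law_moment K) w)" by (intro sum_mono Z(2))
  finally show "(\<integral>\<omega>. T \<omega> \<partial>M) \<le> ?b ^ n * (\<Sum>w\<in>?W. walk_weight (law_moment K) w)"
    by (simp only: sum_distrib_left)
qed

lemma trace_pow_scale: "trace_pow N (\<lambda>i j. c * B i j) n = c ^ n * trace_pow N B n"
proof -
  have "mat_pow N (\<lambda>i j. c * B i j) n i j = c ^ n * mat_pow N B n i j" for i j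
    by (induction n arbitrary: i) (simp_all add: sum_distrib_left mult_ac)
  then show ?thesis by (simp add: trace_pow_def sum_distrib_left)
qed

text \<open>
  The factor \<open>H\<close> in the moment bound \<open>N * (H * D) ^ D\<close> below.
\<close>

definition moment_const :: "real \<Rightarrow> real" where
  "moment_const \<kappa> = (16 * exp 1 * \<kappa>)\<^sup>2 * 48 ^ 6 * 2 * (16 * exp 6)"

text \<open>
  Here the order of the moment is \<open>2 * D\<close>, where \<open>D\<close> is the maximum degree, and the dimension of the
  comparison matrix is \<open>3 * D\<close>. This is large enough for the dimension reduction and small
  enough for the grid estimate to cost only a factor exponential in \<open>D\<close>.
\<close>

lemma expectation_trace_pow_max_degree:
  assumes M: "prob_space M" and sub: "subgaussian_matrix M N (\<kappa>\<^sup>2) G" and \<kappa>: "\<kappa> > 0"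
    and E: "simple_graph N E" and D: "max_degree N E \<ge> 1"
  shows "(\<integral>\<omega>. trace_pow N (hadamard (adjacency E) (G \<omega>)) (2 * max_degree N E) \<partial>M)
           \<le> real N * (moment_const \<kappa> * real (max_degree N E)) ^ max_degree N E"
proof -
  define D where "D = max_degree N E"
  let ?b = "16 * exp 1 * \<kappa>" and ?K = "2 * D" and ?r = "3 * D"
  define S where "S = (\<Sum>w | walk_list (neighbours N E) N w \<and> length w = Suc (2 * D). walk_weight (law_moment ?K) w)"
  have D1: "D \<ge> 1" using D by (simp add: D_def)
  have "real ?r * S \<le> real N * (\<Sum>u | set u \<subseteq> {1..?r} \<and> length u = Suc (2 * D). walk_weight (law_moment ?K) u)"
    unfolding S_def
    by (rule sum_walks_le_sum_lists[where D = D])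
      (use card_neighbours_le[OF E] D1 in \<open>auto simp: D_def intro: walk_weight_same_pattern walk_weight_nonneg law_moment_nonneg\<close>)
  also have "(\<Sum>u | set u \<subseteq> {1..?r} \<and> length u = Suc (2 * D). walk_weight (law_moment ?K) u)
      = law_expect ?K ?r (\<lambda>\<phi>. trace_pow ?r (sym_matrix (law_point ?K) \<phi>) (2 * D))"
    unfolding law_moment_def[abs_def] by (rule prod_expect_trace_pow[symmetric]) (simp_all only: finite_atMost sum_law_weight)
  also have "real N * \<dots> \<le> real N * (real ?r * 48 ^ (2 * ?r) * (2 * (16 * exp 6 * real D) ^ D))"
    using D1 by (intro mult_left_mono law_expect_trace_pow) auto
  also have "\<dots> = real ?r * (real N * (48 ^ (2 * ?r) * (2 * (16 * exp 6 * real D) ^ D)))"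
    by (simp only: mult_ac)
  finally have S: "S \<le> real N * (48 ^ (2 * ?r) * (2 * (16 * exp 6 * real D) ^ D))"
    using D1 by (subst (asm) mult_le_cancel_left_pos) auto
  have "(\<integral>\<omega>. trace_pow N (hadamard (adjacency E) (G \<omega>)) (2 * D) \<partial>M) \<le> ?b ^ (2 * D) * S"
    unfolding S_def by (rule expectation_trace_pow_le[OF M sub \<kappa> E]) simp
  also have "\<dots> \<le> ?b ^ (2 * D) * (real N * (48 ^ (2 * ?r) * (2 ^ D * (16 * exp 6 * real D) ^ D)))"
  proof (rule mult_left_mono)
    have "(2::real) ^ 1 \<le> 2 ^ D" using D1 by (intro power_increasing) auto
    then have "real N * (48 ^ (2 * ?r) * (2 * (16 * exp 6 * real D) ^ D))
        \<le> real N * (48 ^ (2 * ?r) * (2 ^ D * (16 * exp 6 * real D) ^ D))"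
      by (intro mult_left_mono mult_right_mono) auto
    with S show "S \<le> real N * (48 ^ (2 * ?r) * (2 ^ D * (16 * exp 6 * real D) ^ D))" by (rule order_trans)
  qed (use \<kappa> in simp)
  also have "\<dots> = real N * (moment_const \<kappa> * real D) ^ D"
  proof -
    have "?b ^ (2 * D) = (?b\<^sup>2) ^ D" by (rule power_mult)
    moreover have "(48::real) ^ (2 * ?r) = (48 ^ 6) ^ D" by (simp only: power_mult[symmetric] mult.assoc[symmetric]) simp
    ultimately show ?thesis unfolding moment_const_def by (simp only: power_mult_distrib mult_ac)
  qed
  finally show ?thesis by (simp only: D_def)
qed

section \<open>The tail of the operator norm\<close>

text \<open>
  Markov's inequality for the trace gives \<open>N * (H * D / (C\<^sup>2 * d)) ^ D\<close>. The threshold \<open>C\<close> is chosen such that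
  \<open>H * D / (C\<^sup>2 * d) \<le> exp (-2)\<close>; one of the two factors \<open>exp (- D)\<close> absorbs \<open>N\<close>.
\<close>

lemma op_norm_tail:
  assumes M: "prob_space M" and sub: "subgaussian_matrix M N (\<kappa>\<^sup>2) G" and \<kappa>: "\<kappa> > 0"
    and E: "simple_graph N E" "E \<noteq> {}" and N: "N \<ge> 1"
    and C0: "real (max_degree N E) \<le> C0 * avg_degree N E" "C0 > 0"
    and d: "ln (real N) \<le> avg_degree N E"
  shows "measure M {\<omega> \<in> space M. op_norm N (J_matrix N E (G \<omega>)) \<ge> exp 1 * sqrt (moment_const \<kappa> * C0)}
           \<le> exp (- avg_degree N E)"
proof -
  interpret prob_space M by (rule M)
  define d' where "d' = avg_degree N E"
  define D where "D = max_degree N E"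
  define H where "H = moment_const \<kappa>"
  define C where "C = exp 1 * sqrt (H * C0)"
  let ?X = "\<lambda>\<omega>. hadamard (adjacency E) (G \<omega>)"
  have H: "H > 0" using \<kappa> by (simp add: H_def moment_const_def)
  have C: "C > 0" "C\<^sup>2 = exp 2 * (H * C0)"
    using H C0 by (simp_all add: C_def power_mult_distrib flip: exp_of_nat_mult)
  have "card E > 0" using simple_graph_finite[OF E(1)] E(2) by (simp add: card_gt_0_iff)
  then have d0: "d' > 0" using N by (simp add: d'_def avg_degree_def)
  have dD: "d' \<le> real D" unfolding d'_def D_def by (rule avg_degree_le_max_degree[OF E(1) N])
  then have D1: "D \<ge> 1" using d0 by linarith
  have J: "J_matrix N E (G \<omega>) = (\<lambda>i j. (1 / sqrt d') * ?X \<omega> i j)" for \<omega>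
    by (simp add: J_matrix_def[abs_def] d'_def)
  have sym: "?X \<omega> i j = ?X \<omega> j i" if "\<omega> \<in> space M" "i \<in> {1..N}" "j \<in> {1..N}" for \<omega> i j
    using sub that unfolding subgaussian_matrix_def hadamard_def adjacency_def
    by (simp add: insert_commute)
  have int: "integrable M (\<lambda>\<omega>. trace_pow N (?X \<omega>) (2 * D))"
    by (rule expectation_trace_pow_le(1)[OF M sub \<kappa> E(1) order_refl])
  have nonneg: "AE \<omega> in M. 0 \<le> trace_pow N (?X \<omega>) (2 * D)"
    using sym by (intro AE_I2) (subst trace_pow_even, auto intro!: sum_nonneg)
  let ?c = "(C\<^sup>2 * d') ^ D"
  have c0: "?c > 0" using C(1) d0 by (intro zero_less_power mult_pos_pos) auto
  have "{\<omega> \<in> space M. op_norm N (J_matrix N E (G \<omega>)) \<ge> C} \<subseteq> {\<omega> \<in> space M. trace_pow N (?X \<omega>) (2 * D) \<ge> ?c}"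
  proof safe
    fix \<omega> assume \<omega>: "\<omega> \<in> space M" and op: "C \<le> op_norm N (J_matrix N E (G \<omega>))"
    have "(C\<^sup>2) ^ D = C ^ (2 * D)" by (rule power_mult[symmetric])
    also have "\<dots> \<le> op_norm N (J_matrix N E (G \<omega>)) ^ (2 * D)" using op C by (intro power_mono) auto
    also have "\<dots> \<le> trace_pow N (J_matrix N E (G \<omega>)) (2 * D)"
      unfolding J using sym[OF \<omega>] D1 by (intro op_norm_le_trace_pow) simp_all
    also have "\<dots> = (1 / sqrt d') ^ (2 * D) * trace_pow N (?X \<omega>) (2 * D)"
      unfolding J by (rule trace_pow_scale)
    also have "(1 / sqrt d') ^ (2 * D) = 1 / d' ^ D" using d0 by (simp add: power_mult power_divide)
    finally show "?c \<le> trace_pow N (?X \<omega>) (2 * D)" using d0 by (simp add: power_mult_distrib field_simps)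
  qed
  moreover have "{\<omega> \<in> space M. trace_pow N (?X \<omega>) (2 * D) \<ge> ?c} \<in> sets M"
    using borel_measurable_integrable[OF int] by measurable
  ultimately have "measure M {\<omega> \<in> space M. op_norm N (J_matrix N E (G \<omega>)) \<ge> C}
      \<le> measure M {\<omega> \<in> space M. trace_pow N (?X \<omega>) (2 * D) \<ge> ?c}"
    by (rule finite_measure_mono)
  also have "\<dots> \<le> (\<integral>\<omega>. trace_pow N (?X \<omega>) (2 * D) \<partial>M) / ?c"
    by (rule integral_Markov_inequality_measure[OF int sets.top nonneg c0])
  also have "\<dots> \<le> (real N * (H * real D) ^ D) / ?c"
    using expectation_trace_pow_max_degree[OF M sub \<kappa> E(1)] D1 c0
    by (intro divide_right_mono) (simp_all add: D_def H_def)
  also have "\<dots> \<le> (real N * (H * (C0 * d')) ^ D) / ?c"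
    using C0 H c0 by (intro divide_right_mono mult_left_mono power_mono) (simp_all add: D_def d'_def)
  also have "\<dots> = real N * exp (- 2 * real D)"
  proof -
    have "exp (2 * real D) = exp 2 ^ D" by (metis exp_of_nat_mult mult.commute)
    then have "exp (- 2 * real D) = 1 / exp 2 ^ D" by (simp add: exp_minus field_simps)
    moreover have "?c = exp 2 ^ D * (H * (C0 * d')) ^ D"
      unfolding C(2) by (simp only: power_mult_distrib mult_ac)
    moreover have "(H * (C0 * d')) ^ D \<noteq> 0" using H C0 d0 by simp
    ultimately show ?thesis by (simp only: nonzero_mult_divide_mult_cancel_right times_divide_eq_right mult_1_right simp_thms)
  qed
  also have "\<dots> \<le> exp d' * exp (- 2 * real D)"
  proof (rule mult_right_mono)
    have "real N = exp (ln (real N))" using N by simp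
    also have "\<dots> \<le> exp d'" using d by (simp only: exp_le_cancel_iff d'_def)
    finally show "real N \<le> exp d'" .
  qed simp
  also have "\<dots> \<le> exp (- d')" using dD by (simp flip: exp_add)
  finally show ?thesis by (simp only: C_def H_def d'_def)
qed

theorem theorem1p4:
  fixes \<kappa> C\<^sub>0 :: real
    and E :: "nat \<Rightarrow> nat set set"
    and M :: "nat \<Rightarrow> 'a measure"
    and G :: "nat \<Rightarrow> 'a \<Rightarrow> nat \<Rightarrow> nat \<Rightarrow> real"
  assumes "\<kappa> > 0" and "C\<^sub>0 > 0"
    and "\<And>N. N \<ge> 2 \<Longrightarrow> simple_graph N (E N)"
    and "\<And>N. N \<ge> 2 \<Longrightarrow> E N \<noteq> {}"
    and "\<And>N. N \<ge> 2 \<Longrightarrow> prob_space (M N)"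
    and "\<And>N. N \<ge> 2 \<Longrightarrow> subgaussian_matrix (M N) N (\<kappa>\<^sup>2) (G N)"
    and "filterlim (\<lambda>N. avg_degree N (E N) / ln (real N)) at_top sequentially"
    and "\<And>N. N \<ge> 2 \<Longrightarrow> real (max_degree N (E N)) \<le> C\<^sub>0 * avg_degree N (E N)"
  shows "\<exists>C>0. \<exists>K>0. \<forall>N\<ge>2.
           measure (M N) {\<omega> \<in> space (M N). op_norm N (J_matrix N (E N) (G N \<omega>)) \<ge> C}
             \<le> K * exp (- (avg_degree N (E N) / ln (real N)))"
proof -
  define C where "C = exp 1 * sqrt (moment_const \<kappa> * C\<^sub>0)"
  define q where "q N = avg_degree N (E N) / ln (real N)" for N
  let ?P = "\<lambda>N. measure (M N) {\<omega> \<in> space (M N). op_norm N (J_matrix N (E N) (G N \<omega>)) \<ge> C}"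
  have "eventually (\<lambda>N. 1 \<le> q N) sequentially"
    using assms(7) unfolding q_def filterlim_at_top by blast
  then obtain N0 where N0: "\<And>N. N \<ge> N0 \<Longrightarrow> 1 \<le> q N"
    by (auto simp: eventually_sequentially)
  \<comment> \<open>For \<open>N \<ge> 3\<close> moreover \<open>ln N \<ge> 1\<close>, so that \<open>q N\<close> is at most the average degree.\<close>
  define N1 where "N1 = max N0 3"
  define K where "K = 1 + (\<Sum>N<N1. exp (q N))"
  have K1: "K \<ge> 1" unfolding K_def by (simp add: sum_nonneg)
  have "?P N \<le> K * exp (- q N)" if N: "N \<ge> 2" for N
  proof (cases "N < N1")
    case True
    \<comment> \<open>In these finitely many dimensions \<open>K\<close> makes the bound at least \<open>1\<close>.\<close>
    interpret prob_space "M N" by (rule assms(5)[OF N])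
    have "exp (q N) \<le> (\<Sum>N<N1. exp (q N))"
      using True by (intro member_le_sum) auto
    then have "exp (q N) \<le> K" by (simp add: K_def)
    then have "exp (q N) * exp (- q N) \<le> K * exp (- q N)" by (intro mult_right_mono) auto
    then show ?thesis using prob_le_1 by (simp flip: exp_add) (meson order_trans prob_le_1)
  next
    case False
    then have N3: "N \<ge> 3" "1 \<le> q N" using N0 by (auto simp: N1_def)
    have "exp 1 \<le> real N" using N3(1) exp_le by linarith
    then have ln1: "1 \<le> ln (real N)" using N3(1) by (simp add: ln_ge_iff)
    then have d: "ln (real N) \<le> avg_degree N (E N)" using N3(2) by (simp add: q_def field_simps)
    have "?P N \<le> exp (- avg_degree N (E N))"
      unfolding C_def
      by (rule op_norm_tail) (use assms N d in auto)
    also have "\<dots> \<le> exp (- q N)"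
    proof -
      have "0 \<le> avg_degree N (E N)" using ln1 d by linarith
      then have "q N \<le> avg_degree N (E N)" using ln1 unfolding q_def
        by (simp add: divide_le_eq mult_left_le mult_le_cancel_left1)
      then show ?thesis by simp
    qed
    also have "\<dots> \<le> K * exp (- q N)" using K1 by simp
    finally show ?thesis .
  qed
  moreover have "C > 0" using assms(1,2) by (simp add: C_def moment_const_def)
  moreover have "K > 0" using K1 by simp
  ultimately show ?thesis unfolding q_def by blast
qed

end
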